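(* Let $f_1,\dots,f_N:\mathbb{R}^d\to\mathbb{R}$ be differentiable functions such that there are $G,L>0$ with $\|\nabla f_i(x)\|_2\le G$ and $\|\nabla f_i(x)-\nabla f_i(y)\|_2\le L\|x-y\|_2$ for all $x,y\in\mathbb{R}^d$, $i\in[N]$. Let $\{\alpha_t\}$ be a decreasing sequence of positive step-sizes with $\alpha_t=\mathcal{O}(1/t)$. Let $C\ge N$, and for $\delta\in(0,1]$ let $\varepsilon_t:=\dfrac{1}{C^{1-\delta/3}(C+t-1)^{\delta/3}}$ and $t_0:=\min\{t:\varepsilon_t\le\frac1{2N}\}$. Let the processes $\{x_t\},\{I_t\},\{p^t\}$ be generated as described in the context, and put $\mathrm{Regret}_D(T):=\sum_{t=1}^T c_t(p^t)-\sum_{t=1}^T\min_{p\in\Delta}c_t(p)$. (i) If the iterates are those of SGD, $x_{t+1}=x_t-\alpha_t\hat g^t$, and $\delta=1$ in the definition of $\varepsilon_t$, then for all $T\ge t_0$, $$\mathbb{E}[\mathrm{Regret}_D(T)]\le\mathcal{O}(T^{2/3}).$$ (ii) If the iterates are those of SGLD, $x_{t+1}=x_t-\alpha_t\hat g^t+\xi_t$ with $\xi_t\sim\mathcal{N}(0,2\alpha_t I_d)$, and $\delta=1/2$ in the definition of $\varepsilon_t$, then for all $T\ge t_0$, $$\mathbb{E}[\mathrm{Regret}_D(T)]\le\mathcal{O}(T^{5/6}).$$ The implied constants do not depend on $T$.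
   Context: Notation: $[n]=\{1,\dots,n\}$. $\Delta$ is the probability simplex in $\mathbb{R}^N$, and for $\varepsilon\in[0,1/N]$, $\Delta(\varepsilon):=\{p\in\mathbb{R}^N : p_i\ge\varepsilon \text{ for all } i,\ \sum_{i=1}^N p_i=1\}$. Convention in sums $\sum_i a_i^2/p_i$: $\frac10\cdot 0:=0$ and $\frac10\cdot a:=+\infty$ for $a>0$. Process: $x_1\in\mathbb{R}^d$ is deterministic, and $h_1^1,\dots,h_N^1\in\mathbb{R}^d$ are arbitrary deterministic initial vectors (e.g. $0$). At each time $t$: - $g_i^t:=\nabla f_i(x_t)$ and $g^t:=\sum_{i=1}^N g_i^t$; - the surrogate cost is $\widetilde c_t(p):=\sum_{i=1}^N\frac{1}{p_i}\|h_i^t\|_2^2$, and $p^t\in\operatorname{argmin}_{p\in\Delta(\varepsilon_t)}\widetilde c_t(p)$ (if the minimizer is not unique, any choice determined by the past); - an index $I_t\in[N]$ is drawn with conditional distribution $p^t$ given the past, and the gradient estimator is $\hat g^t:=\frac{1}{p^t_{I_t}}\nabla f_{I_t}(x_t)$; - $x_{t+1}$ is computed by the SGD or SGLD update; in the SGLD case the noise $\xi_t$ is independent of the past and of $I_t$; - $h_{I_t}^{t+1}:=g_{I_t}^t$ and $h_i^{t+1}:=h_i^t$ for $i\ne I_t$. True cost: $c_t(p):=\sum_{i=1}^N\frac{1}{p_i}\|g_i^t\|_2^2-\|g^t\|_2^2$. *)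

theory Defs
  imports "HOL-Probability.Probability"
begin

definition grad :: "('a::real_inner \<Rightarrow> real) \<Rightarrow> 'a \<Rightarrow> 'a" where
  "grad f x = (THE D. GDERIV f x :> D)"

text \<open>The index set is a finite type \<open>'n\<close>, so that \<open>N = CARD('n)\<close>. The full probability
  simplex is \<open>prob_simplex 0\<close>.\<close>

definition prob_simplex :: "real \<Rightarrow> (real ^ 'n::finite) set" where
  "prob_simplex eps = {p. (\<forall>i. eps \<le> p $ i) \<and> (\<Sum>i\<in>UNIV. p $ i) = 1}"

text \<open>Division with \<open>0/0 = 0\<close> and \<open>a/0 = \<infinity>\<close> for \<open>a > 0\<close>. The built-in division, where
  \<open>a/0 = 0\<close>, would be wrong on the boundary of the simplex.\<close>

definition quot :: "real \<Rightarrow> real \<Rightarrow> ereal" where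
  "quot a b = (if b = 0 then (if a = 0 then 0 else \<infinity>) else ereal (a / b))"

definition surrogate_cost :: "('n::finite \<Rightarrow> 'a::real_normed_vector) \<Rightarrow> real ^ 'n \<Rightarrow> ereal" where
  "surrogate_cost v p = (\<Sum>i\<in>UNIV. quot ((norm (v i))\<^sup>2) (p $ i))"

definition true_cost :: "('n::finite \<Rightarrow> 'a::real_normed_vector) \<Rightarrow> real ^ 'n \<Rightarrow> ereal" where
  "true_cost g p = surrogate_cost g p - ereal ((norm (\<Sum>i\<in>UNIV. g i))\<^sup>2)"

text \<open>The infimum over the simplex is attained and finite (\<open>true_cost_min_attained\<close> below), so it
  is the minimum.\<close>

definition dynamic_regret ::
  "('n::finite \<Rightarrow> 'a::real_inner \<Rightarrow> real) \<Rightarrow> (nat \<Rightarrow> 'w \<Rightarrow> 'a) \<Rightarrow> (nat \<Rightarrow> 'w \<Rightarrow> real ^ 'n) \<Rightarrow> nat \<Rightarrow> 'w \<Rightarrow> ereal"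
where
  "dynamic_regret f x p T \<omega> =
     (\<Sum>t=1..T. true_cost (\<lambda>i. grad (f i) (x t \<omega>)) (p t \<omega>)) -
     (\<Sum>t=1..T. INF q\<in>prob_simplex 0. true_cost (\<lambda>i. grad (f i) (x t \<omega>)) q)"

definition exploration :: "real \<Rightarrow> real \<Rightarrow> nat \<Rightarrow> real" where
  "exploration C \<delta> t = 1 / (C powr (1 - \<delta> / 3) * (C + real t - 1) powr (\<delta> / 3))"

definition burn_in :: "real \<Rightarrow> (nat \<Rightarrow> real) \<Rightarrow> nat" where
  "burn_in N eps = (LEAST t. 1 \<le> t \<and> eps t \<le> 1 / (2 * N))"

text \<open>The sigma-algebra generated by \<open>Z 1, \<dots>, Z (t - 1)\<close>, for random elements \<open>Z s\<close> of \<open>S\<close>.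
  Time starts at 1; values of processes at time 0 are irrelevant throughout.\<close>

definition past :: "'w measure \<Rightarrow> 'b measure \<Rightarrow> (nat \<Rightarrow> 'w \<Rightarrow> 'b) \<Rightarrow> nat \<Rightarrow> 'w measure" where
  "past M S Z t = sigma (space M) {Z s -` A \<inter> space M | s A. 1 \<le> s \<and> s < t \<and> A \<in> sets S}"

text \<open>The parts common to both algorithms; \<open>F t\<close> is the information available before the draw at
  time \<open>t\<close>. Measurability of \<open>p t\<close> with respect to \<open>F t\<close> says that ties between minimizers are
  broken in a way determined by the past.\<close>

locale adaptive_sampling = prob_space M
  for M :: "'w measure" +
  fixes f :: "'n::finite \<Rightarrow> real ^ 'd::finite \<Rightarrow> real"
    and eps :: "nat \<Rightarrow> real"
    and x1 :: "real ^ 'd" and h1 :: "'n \<Rightarrow> real ^ 'd"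
    and F :: "nat \<Rightarrow> 'w measure"
    and x :: "nat \<Rightarrow> 'w \<Rightarrow> real ^ 'd"
    and h :: "nat \<Rightarrow> 'w \<Rightarrow> 'n \<Rightarrow> real ^ 'd"
    and p :: "nat \<Rightarrow> 'w \<Rightarrow> real ^ 'n"
    and I :: "nat \<Rightarrow> 'w \<Rightarrow> 'n"
  assumes x_init: "\<omega> \<in> space M \<Longrightarrow> x 1 \<omega> = x1"
    and h_init: "\<omega> \<in> space M \<Longrightarrow> h 1 \<omega> = h1"
    and p_argmin: "1 \<le> t \<Longrightarrow> \<omega> \<in> space M \<Longrightarrow>
           is_arg_min (surrogate_cost (h t \<omega>)) (\<lambda>q. q \<in> prob_simplex (eps t)) (p t \<omega>)"
    and p_past: "1 \<le> t \<Longrightarrow> p t \<in> borel_measurable (F t)"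
    and I_measurable: "1 \<le> t \<Longrightarrow> I t \<in> measurable M (count_space UNIV)"
    and I_cond_distr: "1 \<le> t \<Longrightarrow>
           AE \<omega> in M. real_cond_exp M (F t) (indicator {\<omega>' \<in> space M. I t \<omega>' = i}) \<omega> = p t \<omega> $ i"
    and h_step: "1 \<le> t \<Longrightarrow> \<omega> \<in> space M \<Longrightarrow>
           h (Suc t) \<omega> i = (if i = I t \<omega> then grad (f i) (x t \<omega>) else h t \<omega> i)"
begin

definition gradient_estimator :: "nat \<Rightarrow> 'w \<Rightarrow> real ^ 'd" where
  "gradient_estimator t \<omega> = (1 / p t \<omega> $ I t \<omega>) *\<^sub>R grad (f (I t \<omega>)) (x t \<omega>)"

end

locale sgd = adaptive_sampling M f eps x1 h1 "past M (count_space UNIV) I" x h p I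
  for M :: "'w measure" and f :: "'n::finite \<Rightarrow> real ^ 'd::finite \<Rightarrow> real"
    and \<alpha> :: "nat \<Rightarrow> real" and eps x1 h1 x h p I +
  assumes x_step: "1 \<le> t \<Longrightarrow> \<omega> \<in> space M \<Longrightarrow>
           x (Suc t) \<omega> = x t \<omega> - \<alpha> t *\<^sub>R gradient_estimator t \<omega>"

definition gaussian_density :: "real \<Rightarrow> real ^ 'd::finite \<Rightarrow> real" where
  "gaussian_density v z = (\<Prod>j\<in>UNIV. normal_density 0 (sqrt v) (z $ j))"
  \<comment> \<open>density of \<open>\<N>(0, v I)\<close>; the second argument of \<^const>\<open>normal_density\<close> is a standard deviation\<close>

text \<open>The noise \<open>\<xi> t\<close> is required to be independent of the pair consisting of the past and
  \<open>I t\<close>, not merely of each of them separately.\<close>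

locale sgld = adaptive_sampling M f eps x1 h1
    "past M (count_space UNIV \<Otimes>\<^sub>M borel) (\<lambda>s \<omega>. (I s \<omega>, \<xi> s \<omega>))" x h p I
  for M :: "'w measure" and f :: "'n::finite \<Rightarrow> real ^ 'd::finite \<Rightarrow> real"
    and \<alpha> :: "nat \<Rightarrow> real" and eps x1 h1 x h p I and \<xi> :: "nat \<Rightarrow> 'w \<Rightarrow> real ^ 'd" +
  assumes x_step: "1 \<le> t \<Longrightarrow> \<omega> \<in> space M \<Longrightarrow>
           x (Suc t) \<omega> = x t \<omega> - \<alpha> t *\<^sub>R gradient_estimator t \<omega> + \<xi> t \<omega>"
    and noise_distr: "1 \<le> t \<Longrightarrow> distributed M lborel (\<xi> t) (gaussian_density (2 * \<alpha> t))"
    and noise_indep: "1 \<le> t \<Longrightarrow>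
           indep_set
             (sigma_sets (space M)
               (sets (past M (count_space UNIV \<Otimes>\<^sub>M borel) (\<lambda>s \<omega>. (I s \<omega>, \<xi> s \<omega>)) t) \<union>
                {I t -` A \<inter> space M | A. A \<in> sets (count_space UNIV)}))
             {\<xi> t -` B \<inter> space M | B. B \<in> sets borel}"

lemma quot_nonneg: "0 \<le> a \<Longrightarrow> 0 \<le> b \<Longrightarrow> 0 \<le> quot a b"
  by (auto simp: quot_def)

lemma true_cost_finite:
  assumes "p \<in> prob_simplex eps" "0 < eps"
  shows "\<bar>true_cost g p\<bar> \<noteq> \<infinity>"
proof -
  have "p $ i \<noteq> 0" for i
    using assms by (auto simp: prob_simplex_def dest: spec[of _ i])
  then have "surrogate_cost g p = ereal (\<Sum>i\<in>UNIV. (norm (g i))\<^sup>2 / p $ i)"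
    by (simp add: surrogate_cost_def quot_def)
  then show ?thesis
    by (simp add: true_cost_def)
qed

lemma surrogate_cost_lower:
  fixes p :: "real ^ 'n::finite"
  assumes p: "p \<in> prob_simplex 0"
  shows "ereal ((\<Sum>i\<in>UNIV. norm (g i))\<^sup>2) \<le> surrogate_cost g p"
proof (cases "\<exists>i. p $ i = 0 \<and> g i \<noteq> 0")
  case True
  then obtain i where i: "p $ i = 0" "g i \<noteq> 0" by blast
  have nn: "0 \<le> quot ((norm (g j))\<^sup>2) (p $ j)" for j
    using p by (intro quot_nonneg) (auto simp: prob_simplex_def)
  have "quot ((norm (g i))\<^sup>2) (p $ i) \<le> surrogate_cost g p"
    unfolding surrogate_cost_def
    using sum_mono2[of UNIV "{i}" "\<lambda>j. quot ((norm (g j))\<^sup>2) (p $ j)"] nn by simp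
  then show ?thesis
    using i by (simp add: quot_def)
next
  case False
  have p0: "\<And>i. 0 \<le> p $ i" and sum1: "(\<Sum>i\<in>UNIV. p $ i) = 1"
    using p by (auto simp: prob_simplex_def)
  have eq: "surrogate_cost g p = ereal (\<Sum>i\<in>UNIV. (norm (g i))\<^sup>2 / p $ i)"
    using False by (auto simp: surrogate_cost_def quot_def simp flip: sum_ereal intro!: sum.cong)
  have "(\<Sum>i\<in>UNIV. norm (g i)) = (\<Sum>i\<in>UNIV. sqrt (p $ i) * (norm (g i) / sqrt (p $ i)))"
    using False by (intro sum.cong) auto
  also have "\<dots>\<^sup>2 \<le> (\<Sum>i\<in>UNIV. (sqrt (p $ i))\<^sup>2) * (\<Sum>i\<in>UNIV. (norm (g i) / sqrt (p $ i))\<^sup>2)"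
    by (rule Cauchy_Schwarz_ineq_sum)
  also have "\<dots> = (\<Sum>i\<in>UNIV. (norm (g i))\<^sup>2 / p $ i)"
    using p0 sum1 by (simp add: power_divide)
  finally show ?thesis
    by (simp add: eq)
qed

lemma surrogate_cost_attained:
  fixes g :: "'n::finite \<Rightarrow> 'a::real_normed_vector"
  shows "\<exists>q\<in>prob_simplex 0. surrogate_cost g q = ereal ((\<Sum>i\<in>UNIV. norm (g i))\<^sup>2)"
proof (cases "(\<Sum>i\<in>UNIV. norm (g i)) = 0")
  case True
  then have g: "g i = 0" for i
    by (simp add: sum_nonneg_eq_0_iff)
  let ?q = "(\<chi> i. 1 / real CARD('n)) :: real ^ 'n"
  have "?q \<in> prob_simplex 0" "surrogate_cost g ?q = 0"
    by (auto simp: prob_simplex_def surrogate_cost_def quot_def g)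
  then show ?thesis
    using True by (intro bexI[of _ ?q]) auto
next
  case False
  define S where "S = (\<Sum>i\<in>UNIV. norm (g i))"
  have S: "S > 0"
    using False unfolding S_def by (metis less_eq_real_def norm_ge_zero sum_nonneg)
  let ?q = "(\<chi> i. norm (g i) / S) :: real ^ 'n"
  have 1: "?q \<in> prob_simplex 0"
    using S by (auto simp: prob_simplex_def S_def simp flip: sum_divide_distrib)
  have "quot ((norm (g i))\<^sup>2) (?q $ i) = ereal (norm (g i) * S)" for i
    using S by (auto simp: quot_def power2_eq_square)
  then have "surrogate_cost g ?q = ereal (S\<^sup>2)"
    by (simp add: surrogate_cost_def power2_eq_square S_def flip: sum_distrib_right)
  with 1 show ?thesis
    unfolding S_def by blast
qed

lemma true_cost_min:
  "(INF q\<in>prob_simplex 0. true_cost g q) =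
     ereal ((\<Sum>i\<in>UNIV. norm (g i))\<^sup>2 - (norm (\<Sum>i\<in>UNIV. g i))\<^sup>2)"
proof (rule antisym)
  obtain q where "q \<in> prob_simplex 0" "surrogate_cost g q = ereal ((\<Sum>i\<in>UNIV. norm (g i))\<^sup>2)"
    using surrogate_cost_attained by blast
  then show "(INF q\<in>prob_simplex 0. true_cost g q) \<le>
      ereal ((\<Sum>i\<in>UNIV. norm (g i))\<^sup>2 - (norm (\<Sum>i\<in>UNIV. g i))\<^sup>2)"
    by (intro INF_lower2[of q]) (auto simp: true_cost_def)
next
  show "ereal ((\<Sum>i\<in>UNIV. norm (g i))\<^sup>2 - (norm (\<Sum>i\<in>UNIV. g i))\<^sup>2) \<le>
      (INF q\<in>prob_simplex 0. true_cost g q)"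
  proof (rule INF_greatest)
    fix q :: "real ^ 'a" assume "q \<in> prob_simplex 0"
    from surrogate_cost_lower[OF this, of g]
    show "ereal ((\<Sum>i\<in>UNIV. norm (g i))\<^sup>2 - (norm (\<Sum>i\<in>UNIV. g i))\<^sup>2) \<le> true_cost g q"
      unfolding true_cost_def
      by (metis ereal_minus(1) ereal_minus_mono order_refl)
  qed
qed

lemma true_cost_min_attained:
  "\<exists>q\<in>prob_simplex 0. true_cost g q = (INF q\<in>prob_simplex 0. true_cost g q)"
  "\<bar>INF q\<in>prob_simplex 0. true_cost g q\<bar> \<noteq> \<infinity>"
proof -
  obtain q where q: "q \<in> prob_simplex 0" "surrogate_cost g q = ereal ((\<Sum>i\<in>UNIV. norm (g i))\<^sup>2)"
    using surrogate_cost_attained by blast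
  show "\<exists>q\<in>prob_simplex 0. true_cost g q = (INF q\<in>prob_simplex 0. true_cost g q)"
    unfolding true_cost_min by (rule bexI[OF _ q(1)]) (simp add: true_cost_def q(2))
  show "\<bar>INF q\<in>prob_simplex 0. true_cost g q\<bar> \<noteq> \<infinity>"
    by (simp add: true_cost_min)
qed

text \<open>Consequently the regret is a real number, and applying \<^const>\<open>real_of_ereal\<close> to it loses
  nothing.\<close>

lemma (in adaptive_sampling) dynamic_regret_finite:
  assumes "\<And>t. 1 \<le> t \<Longrightarrow> 0 < eps t" "\<omega> \<in> space M"
  shows "\<bar>dynamic_regret f x p T \<omega>\<bar> \<noteq> \<infinity>"
proof -
  have fin: "\<bar>true_cost (\<lambda>i. grad (f i) (x t \<omega>)) (p t \<omega>)\<bar> \<noteq> \<infinity>" if "t \<in> {1..T}" for t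
    using that assms p_argmin[of t \<omega>]
    by (intro true_cost_finite[of _ "eps t"]) (auto simp: is_arg_min_def)
  have "\<bar>\<Sum>t=1..T. true_cost (\<lambda>i. grad (f i) (x t \<omega>)) (p t \<omega>)\<bar> \<noteq> \<infinity>"
    using fin by (simp only: sum_Inf) auto
  then show ?thesis
    unfolding dynamic_regret_def true_cost_min by auto
qed

end

theory Submission
  imports Defs
begin

text \<open>The regret of one round is controlled by the staleness \<open>s\<^sub>t = (\<Sum>i. \<parallel>g\<^sub>i - h\<^sub>i\<parallel>)\<close>: since \<open>p \<ge> \<epsilon>\<^sub>t\<close>
  on the restricted simplex, it is \<open>O(s\<^sub>t / \<epsilon>\<^sub>t + \<epsilon>\<^sub>t)\<close>, where \<open>\<epsilon>\<^sub>t\<close> is the price of the restriction.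
  Each stored gradient is refreshed with conditional probability at least \<open>\<epsilon>\<^sub>t\<close>, hence
  \<open>E s\<^bsub>t+1\<^esub> \<le> (1 - \<epsilon>\<^sub>t) E s\<^sub>t + c\<^sub>t\<close>, where \<open>c\<^sub>t\<close> is proportional to the expected length of the step.
  Dividing by \<open>\<epsilon>\<^sub>t\<^sup>2\<close> and summing by parts gives \<open>(\<Sum>t\<le>T. E s\<^sub>t / \<epsilon>\<^sub>t) = O(1 / \<epsilon>\<^sub>T\<^sup>2 + (\<Sum>t\<le>T. c\<^sub>t / \<epsilon>\<^sub>t\<^sup>2))\<close>.
  Importance weighting cancels \<open>1 / p\<close> in expectation, so \<open>c\<^sub>t\<close> is of order \<open>t powr - \<delta>\<close>: \<open>1 / t\<close> for SGD,
  and \<open>1 / sqrt t\<close> (from the noise) for SGLD. With \<open>\<epsilon>\<^sub>t\<close> of order \<open>t powr - (\<delta> / 3)\<close> all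
  contributions are \<open>O(T powr (1 - \<delta> / 3))\<close>.\<close>

subsection \<open>Deterministic estimates\<close>

lemma surrogate_cost_eq_sum:
  assumes "p \<in> prob_simplex e" "0 < e"
  shows "surrogate_cost v p = ereal (\<Sum>i\<in>UNIV. (norm (v i))\<^sup>2 / p $ i)"
proof -
  have "p $ i \<noteq> 0" for i
    using assms by (auto simp: prob_simplex_def dest: spec[of _ i])
  then show ?thesis
    by (simp add: surrogate_cost_def quot_def)
qed

text \<open>Up to the threshold \<open>N * e = 1 / 2\<close> the minimizer is compared with an
  explicit point of the restricted simplex, at a relative loss of order \<open>N * e\<close>. Above
  it, \<open>1 / e\<close> is itself at most \<open>4 * N\<^sup>2 * e\<close>, so the crude bound
  \<open>B\<^sup>2 / e\<close> per term suffices; this case dictates the constant 4.\<close>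

lemma argmin_excess_cost:
  fixes v :: "'n::finite \<Rightarrow> 'a::real_normed_vector"
  assumes argmin: "is_arg_min (surrogate_cost v) (\<lambda>q. q \<in> prob_simplex e) p"
    and e: "0 < e" and bound: "\<And>i. norm (v i) \<le> B"
  shows "(\<Sum>i\<in>UNIV. (norm (v i))\<^sup>2 / p $ i) - (\<Sum>i\<in>UNIV. norm (v i))\<^sup>2
           \<le> 4 * real CARD('n) ^ 3 * B\<^sup>2 * e"
proof -
  define N where "N = real CARD('n)"
  define S where "S = (\<Sum>i\<in>UNIV. norm (v i))"
  have N: "N \<ge> 1" unfolding N_def by (simp add: Suc_leI)
  have B: "B \<ge> 0" using bound[of undefined] norm_ge_zero order_trans by blast
  have p: "p \<in> prob_simplex e"
    using argmin by (simp add: is_arg_min_def)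
  have pe: "e \<le> p $ i" for i
    using p by (simp add: prob_simplex_def)
  have S: "0 \<le> S" "S \<le> N * B"
    unfolding S_def N_def using sum_bounded_above[of UNIV "\<lambda>i. norm (v i)" B] bound
    by (auto intro: sum_nonneg)
  show ?thesis
  proof (cases "N * e \<le> 1 / 2")
    case small: True
    show ?thesis
    proof (cases "S = 0")
      case True
      then have "norm (v i) = 0" for i
        unfolding S_def by (simp add: sum_nonneg_eq_0_iff)
      then show ?thesis using B e by simp
    next
      case False
      with S have Spos: "S > 0" by simp
      \<comment> \<open>The unrestricted optimum \<open>norm (v i) / S\<close> mixed with the
        uniform distribution, with weights \<open>1 - N * e\<close> and \<open>N * e\<close>; the
        uniform part adds exactly \<open>e\<close> to every coordinate.\<close>
      define q :: "real ^ 'n" where "q = (\<chi> i. (1 - N * e) * (norm (v i) / S) + e)"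
      have q: "q \<in> prob_simplex e"
        using small Spos
        by (auto simp: prob_simplex_def q_def sum.distrib N_def S_def
              simp flip: sum_divide_distrib sum_distrib_left)
      have "\<not> surrogate_cost v q < surrogate_cost v p"
        using argmin q by (auto simp: is_arg_min_def)
      then have "(\<Sum>i\<in>UNIV. (norm (v i))\<^sup>2 / p $ i) \<le> (\<Sum>i\<in>UNIV. (norm (v i))\<^sup>2 / q $ i)"
        using surrogate_cost_eq_sum[OF p e, of v] surrogate_cost_eq_sum[OF q e, of v] by simp
      \<comment> \<open>Dropping the uniform part of \<open>q\<close> bounds each term by its value
        at the unrestricted optimum, divided by \<open>1 - N * e\<close>.\<close>
      also have "\<dots> \<le> (\<Sum>i\<in>UNIV. norm (v i) * S / (1 - N * e))"
      proof (rule sum_mono)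
        fix i
        show "(norm (v i))\<^sup>2 / q $ i \<le> norm (v i) * S / (1 - N * e)"
        proof (cases "v i = 0")
          case False
          have "(norm (v i))\<^sup>2 / q $ i \<le> (norm (v i))\<^sup>2 / ((1 - N * e) * (norm (v i) / S))"
          proof -
            have "0 < (1 - N * e) * (norm (v i) / S)"
              using False small Spos by (intro mult_pos_pos divide_pos_pos) auto
            then show ?thesis
              using e unfolding q_def by (intro frac_le) auto
          qed
          also have "\<dots> = norm (v i) * S / (1 - N * e)"
            using False small Spos by (simp add: power2_eq_square field_simps)
          finally show ?thesis .
        qed simp
      qed
      also have "\<dots> = S\<^sup>2 / (1 - N * e)"
        by (simp add: S_def power2_eq_square flip: sum_divide_distrib sum_distrib_right)
      also have "\<dots> = S\<^sup>2 + S\<^sup>2 * (N * e / (1 - N * e))"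
        using small by (simp add: field_simps)
      finally have 1: "(\<Sum>i\<in>UNIV. (norm (v i))\<^sup>2 / p $ i) - S\<^sup>2 \<le> S\<^sup>2 * (N * e / (1 - N * e))"
        by simp
      have "N * e / (1 - N * e) \<le> 2 * N * e"
      proof -
        have "N * e * 1 \<le> N * e * (2 * (1 - N * e))"
          using small N e by (intro mult_left_mono) auto
        then show ?thesis using small by (simp add: field_simps)
      qed
      then have "S\<^sup>2 * (N * e / (1 - N * e)) \<le> (N * B)\<^sup>2 * (2 * N * e)"
        using small N e S by (intro mult_mono power_mono) auto
      also have "\<dots> = 2 * N ^ 3 * B\<^sup>2 * e"
        by (simp add: power2_eq_square power3_eq_cube)
      also have "\<dots> \<le> 4 * N ^ 3 * B\<^sup>2 * e"
        using N e by (intro mult_right_mono) auto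
      finally show ?thesis using 1 unfolding N_def S_def by simp
    qed
  next
    case False
    have "(\<Sum>i\<in>UNIV. (norm (v i))\<^sup>2 / p $ i) \<le> (\<Sum>i\<in>(UNIV :: 'n set). B\<^sup>2 / e)"
      using bound pe e B by (intro sum_mono frac_le power_mono) auto
    also have "\<dots> = N * B\<^sup>2 * (1 / e)" by (simp add: N_def)
    also have "\<dots> \<le> N * B\<^sup>2 * (4 * N\<^sup>2 * e)"
    proof (intro mult_left_mono)
      have "1 \<le> (2 * (N * e))\<^sup>2"
        using False by (intro one_le_power) auto
      then show "1 / e \<le> 4 * N\<^sup>2 * e"
        using e by (simp add: field_simps power2_eq_square)
    qed (use N in auto)
    also have "\<dots> = 4 * N ^ 3 * B\<^sup>2 * e"
      by (simp add: power2_eq_square power3_eq_cube)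
    finally show ?thesis
      unfolding N_def by (smt (verit) zero_le_power2)
  qed
qed

text \<open>Pass from \<open>g\<close> to \<open>v\<close> in the cost of \<open>p\<close>, where
  \<open>1 / p $ i\<close> is at most \<open>1 / e\<close>; use that \<open>p\<close> is nearly
  optimal for \<open>v\<close>; then pass back to \<open>g\<close> in the optimal value. With
  \<open>D\<close> the total distance between \<open>g\<close> and \<open>v\<close>, each passage
  costs at most \<open>2 * N * B / e * D\<close>, whence the factor 4.\<close>

lemma argmin_regret_bound:
  fixes g v :: "'n::finite \<Rightarrow> 'a::real_normed_vector"
  assumes argmin: "is_arg_min (surrogate_cost v) (\<lambda>q. q \<in> prob_simplex e) p"
    and e: "0 < e" "e \<le> 1" and v: "\<And>i. norm (v i) \<le> B" and g: "\<And>i. norm (g i) \<le> B"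
  shows "(\<Sum>i\<in>UNIV. (norm (g i))\<^sup>2 / p $ i) - (\<Sum>i\<in>UNIV. norm (g i))\<^sup>2
           \<le> 4 * real CARD('n) * B / e * (\<Sum>i\<in>UNIV. norm (g i - v i))
               + 4 * real CARD('n) ^ 3 * B\<^sup>2 * e"
proof -
  define N where "N = real CARD('n)"
  define D where "D = (\<Sum>i\<in>UNIV. norm (g i - v i))"
  have N: "N \<ge> 1" unfolding N_def by (simp add: Suc_leI)
  have B: "B \<ge> 0" using v[of undefined] norm_ge_zero order_trans by blast
  have D: "D \<ge> 0" unfolding D_def by (simp add: sum_nonneg)
  have pe: "e \<le> p $ i" for i
    using argmin by (simp add: is_arg_min_def prob_simplex_def)
  have sq: "\<bar>a\<^sup>2 - b\<^sup>2\<bar> \<le> 2 * c * d" if "0 \<le> a" "0 \<le> b" "a \<le> c" "b \<le> c" "\<bar>a - b\<bar> \<le> d" for a b c d :: real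
  proof -
    have "\<bar>a\<^sup>2 - b\<^sup>2\<bar> = (a + b) * \<bar>a - b\<bar>"
      using that by (simp add: power2_eq_square square_diff_square_factored abs_mult)
    also have "\<dots> \<le> (2 * c) * d"
      using that by (intro mult_mono) auto
    finally show ?thesis by simp
  qed
  have "(\<Sum>i\<in>UNIV. (norm (g i))\<^sup>2 / p $ i) - (\<Sum>i\<in>UNIV. (norm (v i))\<^sup>2 / p $ i)
      = (\<Sum>i\<in>UNIV. ((norm (g i))\<^sup>2 - (norm (v i))\<^sup>2) / p $ i)"
    by (simp add: diff_divide_distrib sum_subtractf)
  also have "\<dots> \<le> (\<Sum>i\<in>UNIV. 2 * B * norm (g i - v i) / e)"
  proof (rule sum_mono)
    fix i
    have "(norm (g i))\<^sup>2 - (norm (v i))\<^sup>2 \<le> 2 * B * norm (g i - v i)"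
      using sq[of "norm (g i)" "norm (v i)" B "norm (g i - v i)"] g v norm_triangle_ineq3[of "g i" "v i"] by auto
    then have "((norm (g i))\<^sup>2 - (norm (v i))\<^sup>2) / p $ i \<le> 2 * B * norm (g i - v i) / p $ i"
      using pe[of i] e by (intro divide_right_mono) auto
    also have "\<dots> \<le> 2 * B * norm (g i - v i) / e"
      using pe[of i] e B by (intro divide_left_mono) auto
    finally show "((norm (g i))\<^sup>2 - (norm (v i))\<^sup>2) / p $ i \<le> 2 * B * norm (g i - v i) / e" .
  qed
  also have "\<dots> = 2 * B * D / e"
    by (simp add: D_def flip: sum_divide_distrib sum_distrib_left)
  also have "\<dots> \<le> 2 * N * B / e * D"
    using N B D e by (simp add: divide_simps mult_mono)
  finally have 1: "(\<Sum>i\<in>UNIV. (norm (g i))\<^sup>2 / p $ i) - (\<Sum>i\<in>UNIV. (norm (v i))\<^sup>2 / p $ i) \<le> \<dots>" .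
  have "\<bar>(\<Sum>i\<in>UNIV. norm (g i)) - (\<Sum>i\<in>UNIV. norm (v i))\<bar> \<le> D"
    unfolding D_def sum_subtractf[symmetric]
    by (rule order_trans[OF sum_abs]) (intro sum_mono norm_triangle_ineq3)
  then have "\<bar>(\<Sum>i\<in>UNIV. norm (g i))\<^sup>2 - (\<Sum>i\<in>UNIV. norm (v i))\<^sup>2\<bar> \<le> 2 * (N * B) * D"
    using sum_bounded_above[of UNIV "\<lambda>i. norm (v i)" B] sum_bounded_above[of UNIV "\<lambda>i. norm (g i)" B] v g
    by (intro sq) (auto intro: sum_nonneg simp: N_def)
  \<comment> \<open>The factor \<open>1 / e\<close> is at least 1 and is inserted to match the first
    passage.\<close>
  also have "\<dots> \<le> 2 * N * B / e * D"
    using N B D e by (simp add: divide_simps mult_left_mono mult_left_le)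
  finally have 2: "(\<Sum>i\<in>UNIV. norm (v i))\<^sup>2 - (\<Sum>i\<in>UNIV. norm (g i))\<^sup>2 \<le> 2 * N * B / e * D"
    by linarith
  have "(\<Sum>i\<in>UNIV. (norm (g i))\<^sup>2 / p $ i) - (\<Sum>i\<in>UNIV. norm (g i))\<^sup>2
      \<le> 2 * N * B / e * D + 2 * N * B / e * D + 4 * N ^ 3 * B\<^sup>2 * e"
    using 1 2 argmin_excess_cost[OF argmin e(1) v] unfolding N_def[symmetric] by linarith
  also have "2 * N * B / e * D + 2 * N * B / e * D = 4 * N * B / e * D"
    by simp
  finally show ?thesis
    unfolding D_def N_def .
qed

text \<open>Read as \<open>eps t * d t \<le> d t - d (Suc t) + c t\<close>, the recursion bounds
  each term by a telescoping difference plus a drift. Dividing by \<open>(eps t)\<^sup>2\<close>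
  produces \<open>d t / eps t\<close> on the left, at the price of weights on the differences, which
  the uniform bound \<open>B\<close> absorbs.\<close>

lemma weighted_sum_contraction:
  fixes d c eps :: "nat \<Rightarrow> real"
  assumes eps: "\<And>t. 1 \<le> t \<Longrightarrow> 0 < eps t" "\<And>t. 1 \<le> t \<Longrightarrow> eps (Suc t) \<le> eps t"
    and d: "\<And>t. 1 \<le> t \<Longrightarrow> 0 \<le> d t" "\<And>t. 1 \<le> t \<Longrightarrow> d t \<le> B"
    and step: "\<And>t. 1 \<le> t \<Longrightarrow> d (Suc t) \<le> (1 - eps t) * d t + c t"
    and T: "1 \<le> T"
  shows "(\<Sum>t=1..T. d t / eps t) \<le> B / (eps T)\<^sup>2 + (\<Sum>t=1..T. c t / (eps t)\<^sup>2)"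
proof -
  have *: "d t / eps t \<le> (d t - d (Suc t)) / (eps t)\<^sup>2 + c t / (eps t)\<^sup>2" if "1 \<le> t" for t
  proof -
    have "eps t * d t / (eps t)\<^sup>2 \<le> (d t - d (Suc t) + c t) / (eps t)\<^sup>2"
      using step[OF that] by (intro divide_right_mono) (auto simp: algebra_simps)
    then show ?thesis
      using eps(1)[OF that] by (simp add: power2_eq_square add_divide_distrib)
  qed
  \<comment> \<open>Abel summation: the weights \<open>1 / (eps t)\<^sup>2\<close> increase.\<close>
  have "(\<Sum>t=1..T. (d t - d (Suc t)) / (eps t)\<^sup>2) \<le> (B - d (Suc T)) / (eps T)\<^sup>2"
    using T
  proof (induction T rule: dec_induct)
    case base
    show ?case using d(2)[of 1] by (simp add: divide_right_mono)
  next
    case (step n)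
    \<comment> \<open>The numerator is nonnegative, so the larger weight only increases the bound;
      adding the next difference then turns it into \<open>B - d (Suc (Suc n))\<close>.\<close>
    have "(B - d (Suc n)) / (eps n)\<^sup>2 \<le> (B - d (Suc n)) / (eps (Suc n))\<^sup>2"
      using step.hyps eps[of n] eps(1)[of "Suc n"] d(2)[of "Suc n"]
      by (intro divide_left_mono power_mono) auto
    then show ?case
      using step by (simp add: diff_divide_distrib)
  qed
  also have "\<dots> \<le> B / (eps T)\<^sup>2"
    using d(1)[of "Suc T"] by (intro divide_right_mono) auto
  finally have "(\<Sum>t=1..T. (d t - d (Suc t)) / (eps t)\<^sup>2 + c t / (eps t)\<^sup>2)
      \<le> B / (eps T)\<^sup>2 + (\<Sum>t=1..T. c t / (eps t)\<^sup>2)"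
    by (simp add: sum.distrib)
  moreover have "(\<Sum>t=1..T. d t / eps t) \<le> (\<Sum>t=1..T. (d t - d (Suc t)) / (eps t)\<^sup>2 + c t / (eps t)\<^sup>2)"
    using * by (intro sum_mono) auto
  ultimately show ?thesis by linarith
qed

section \<open>Power sums and the order of the exploration rate\<close>

lemma sum_powr_neg_le:
  assumes k: "0 \<le> k" "k < 1"
  shows "(\<Sum>t=1..T. real t powr - k) \<le> real T powr (1 - k) / (1 - k)"
proof (induction T)
  case (Suc T)
  have "(1 - k) * real (Suc T) powr - k \<le> real (Suc T) powr (1 - k) - real T powr (1 - k)"
  proof (cases "T = 0")
    case False
    \<comment> \<open>Comparison with the integral of the decreasing function
      \<open>z powr - k\<close>, in the form of the mean value theorem for
      \<open>z powr (1 - k)\<close>. The case \<open>T = 0\<close> is separate because the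
      derivative formula needs a positive argument.\<close>
    have "\<exists>z. real T < z \<and> z < real (Suc T) \<and>
        real (Suc T) powr (1 - k) - real T powr (1 - k)
          = (real (Suc T) - real T) * ((1 - k) * z powr (1 - k - 1))"
      by (intro MVT2) (use False has_real_derivative_powr[of _ "1 - k"] in auto)
    then obtain z where z: "real T < z" "z < real (Suc T)"
      "real (Suc T) powr (1 - k) - real T powr (1 - k) = (1 - k) * z powr - k"
      by auto
    have "real (Suc T) powr - k \<le> z powr - k"
      using z(1,2) k by (intro powr_mono2') auto
    then show ?thesis unfolding z(3) using k by (intro mult_left_mono) auto
  qed (use k in auto)
  then have "real (Suc T) powr - k \<le> (real (Suc T) powr (1 - k) - real T powr (1 - k)) / (1 - k)"
    using k by (simp add: field_simps)
  with Suc show ?case by (simp add: diff_divide_distrib)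
qed simp

text \<open>For \<open>C\<close> at least 1 the denominator of the exploration rate lies between
  \<open>real t powr (\<delta> / 3)\<close> and \<open>C\<close> times this power, so the rate is
  exactly of the order \<open>real t powr - (\<delta> / 3)\<close>.\<close>

lemma exploration_bounds:
  assumes "1 \<le> C" "0 \<le> \<delta>" "\<delta> \<le> 1" "1 \<le> t"
  shows "0 < exploration C \<delta> t" "exploration C \<delta> t \<le> real t powr - (\<delta> / 3)"
    "exploration C \<delta> t \<le> 1" "1 / exploration C \<delta> t \<le> C * real t powr (\<delta> / 3)"
    "exploration C \<delta> (Suc t) \<le> exploration C \<delta> t"
proof -
  have t: "1 \<le> real t" using assms(4) by simp
  let ?D = "\<lambda>t. C powr (1 - \<delta> / 3) * (C + real t - 1) powr (\<delta> / 3)"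
  have C: "1 \<le> C powr (1 - \<delta> / 3)" using assms by (intro ge_one_powr_ge_zero) auto
  have low: "1 * real t powr (\<delta> / 3) \<le> ?D t"
    using assms C t by (intro mult_mono powr_mono2) auto
  have tp: "1 \<le> real t powr (\<delta> / 3)" using assms t by (intro ge_one_powr_ge_zero) auto
  show pos: "0 < exploration C \<delta> t"
    using assms by (auto simp: exploration_def)
  show "exploration C \<delta> t \<le> real t powr - (\<delta> / 3)"
    using low tp assms(4) by (auto simp: exploration_def powr_minus_divide intro!: frac_le)
  show "exploration C \<delta> t \<le> 1"
    using low tp assms(4) unfolding exploration_def by (simp add: divide_simps)
  \<comment> \<open>The difference of the two sides is
    \<open>(C - 1) * (real t - 1)\<close>.\<close>
  have "C + real t - 1 \<le> C * real t"
    using mult_nonneg_nonneg[of "C - 1" "real t - 1"] assms(1) t by (simp add: algebra_simps)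
  then have "?D t \<le> C powr (1 - \<delta> / 3) * (C * real t) powr (\<delta> / 3)"
    using assms t by (intro mult_left_mono powr_mono2) auto
  also have "\<dots> = C * real t powr (\<delta> / 3)"
    using assms by (simp add: powr_mult flip: powr_add mult.assoc)
  finally show "1 / exploration C \<delta> t \<le> C * real t powr (\<delta> / 3)"
    by (simp add: exploration_def)
  show "exploration C \<delta> (Suc t) \<le> exploration C \<delta> t"
    unfolding exploration_def using assms
    by (intro divide_left_mono mult_left_mono powr_mono2 mult_pos_pos) auto
qed

text \<open>The Landau bound holds only eventually; boundedness of the whole sequence
  \<open>\<alpha> t * real t\<close> extends it to every \<open>t\<close> from 1 on, so that sums
  starting at 1 can be estimated term by term.\<close>

lemma bigo_inverse_nat_bound:
  assumes "\<alpha> \<in> O(\<lambda>t. 1 / real t)"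
  obtains A where "A > 0" "\<And>t. 1 \<le> t \<Longrightarrow> \<bar>\<alpha> t\<bar> \<le> A / real t"
proof -
  obtain c where c: "c > 0" "\<forall>\<^sub>F t in sequentially. norm (\<alpha> t) \<le> c * norm (1 / real t)"
    using assms by (rule landau_o.bigE)
  have "\<forall>\<^sub>F t in sequentially. norm (\<alpha> t * real t) \<le> c"
    using c(2) eventually_gt_at_top[of 0] by eventually_elim (simp add: field_simps abs_mult)
  then have "Bseq (\<lambda>t. \<alpha> t * real t)"
    by (rule BfunI)
  then obtain A where A: "A > 0" "\<And>t. norm (\<alpha> t * real t) \<le> A"
    by (auto elim: BseqE)
  show ?thesis
    using A by (intro that[of A]) (auto simp: field_simps abs_mult)
qed

subsection \<open>The past and the Gaussian noise\<close>

lemma subalgebra_past: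
  assumes "\<And>s. 1 \<le> s \<Longrightarrow> Z s \<in> measurable M S"
  shows "subalgebra M (past M S Z t)"
  unfolding subalgebra_def past_def
  using assms by (auto intro!: sets.sigma_sets_subset simp: space_measure_of_conv sets_measure_of_conv)

lemma subalgebra_past_Suc: "subalgebra (past M S Z (Suc t)) (past M S Z t)"
proof -
  have "sets (past M S Z t) \<subseteq> sets (past M S Z (Suc t))"
    unfolding past_def
    by (subst (1 2) sets_measure_of; (intro sigma_sets_mono' Collect_mono)?) (auto intro: less_SucI)
  then show ?thesis by (simp add: subalgebra_def past_def space_measure_of_conv)
qed

lemma measurable_past:
  assumes "Z s \<in> measurable M S" "1 \<le> s" "s < t"
  shows "Z s \<in> measurable (past M S Z t) S"
proof (rule measurableI)
  fix A assume "A \<in> sets S"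
  then have "Z s -` A \<inter> space M \<in> {Z s -` A \<inter> space M | s A. 1 \<le> s \<and> s < t \<and> A \<in> sets S}"
    using assms by blast
  then show "Z s -` A \<inter> space (past M S Z t) \<in> sets (past M S Z t)"
    unfolding past_def by (subst sets_measure_of) (auto simp: space_measure_of_conv)
qed (use measurable_space[OF assms(1)] in \<open>simp add: past_def space_measure_of_conv\<close>)

section \<open>First absolute moment of the Gaussian noise\<close>

lemma borel_measurable_vec_nth [measurable (raw)]:
  fixes X :: "'w \<Rightarrow> real ^ 'd::finite"
  shows "X \<in> borel_measurable M \<Longrightarrow> (\<lambda>\<omega>. X \<omega> $ k) \<in> borel_measurable M"
  by (simp add: cart_eq_inner_axis)

lemma nn_integral_abs_normal_density:
  assumes "s > 0"
  shows "(\<integral>\<^sup>+z. ennreal (normal_density 0 s z * \<bar>z\<bar>) \<partial>lborel) \<le> ennreal s"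
proof -
  have "(\<integral>\<^sup>+z. ennreal (normal_density 0 s z * \<bar>z\<bar>) \<partial>lborel) = ennreal (s * sqrt (2 / pi))"
    using normal_moment_abs_odd[OF assms, of 0 0]
    by (subst nn_integral_eq_integral) (auto simp: has_bochner_integral_iff)
  \<comment> \<open>The exact mean carries the factor \<open>sqrt (2 / pi)\<close>, which is at most
    1.\<close>
  also have "\<dots> \<le> ennreal s"
    using assms pi_ge_two by (intro ennreal_leI mult_left_le) auto
  finally show ?thesis .
qed

text \<open>The integrand is a product of functions of one coordinate each, so the integral factors:
  the \<open>k\<close>-th factor is a one-dimensional absolute moment, and the others are normal
  densities with integral 1.\<close>

lemma nn_integral_gaussian_density_component:
  fixes k :: "'d::finite"
  assumes "v > 0"
  shows "(\<integral>\<^sup>+z. ennreal (gaussian_density v z) * ennreal \<bar>z $ k\<bar> \<partial>lborel) \<le> ennreal (sqrt v)"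
proof -
  let ?n = "normal_density 0 (sqrt v)"
  \<comment> \<open>The factors are indexed by basis vectors because the product rule for
    \<open>lborel\<close> runs over \<open>Basis\<close>.\<close>
  let ?f = "\<lambda>(b :: real ^ 'd) u. if b = axis k 1 then ?n u * \<bar>u\<bar> else ?n u"
  have Basis: "(Basis :: (real ^ 'd) set) = (\<lambda>j. axis j 1) ` UNIV"
    by (auto simp: Basis_vec_def)
  have inj: "inj_on (\<lambda>j :: 'd. axis j (1 :: real)) UNIV"
    by (auto intro!: injI simp: axis_eq_axis)
  have "gaussian_density v z * \<bar>z $ k\<bar> = (\<Prod>b\<in>Basis. ?f b (z \<bullet> b))" for z
  proof -
    have "(\<Prod>b\<in>Basis. ?f b (z \<bullet> b)) = (\<Prod>j\<in>UNIV. ?n (z $ j) * (if j = k then \<bar>z $ j\<bar> else 1))"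
      by (auto simp: Basis prod.reindex[OF inj] inner_axis axis_eq_axis intro!: prod.cong)
    also have "\<dots> = gaussian_density v z * \<bar>z $ k\<bar>"
      by (simp add: prod.distrib gaussian_density_def)
    finally show ?thesis by simp
  qed
  then have "(\<integral>\<^sup>+z. ennreal (gaussian_density v z) * ennreal \<bar>z $ k\<bar> \<partial>lborel)
      = (\<integral>\<^sup>+z. (\<Prod>b\<in>Basis. ennreal (?f b (z \<bullet> b))) \<partial>lborel)"
    by (subst prod_ennreal) (auto simp flip: ennreal_mult'')
  also have "\<dots> = (\<Prod>b\<in>Basis. \<integral>\<^sup>+u. ennreal (?f b u) \<partial>lborel)"
    by (intro nn_integral_lborel_prod) auto
  also have "\<dots> = (\<Prod>j\<in>UNIV. if j = k then \<integral>\<^sup>+u. ennreal (?n u * \<bar>u\<bar>) \<partial>lborel else 1)"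
  proof -
    have "(\<integral>\<^sup>+u. ennreal (?n u) \<partial>lborel) = 1"
      using assms by (subst nn_integral_eq_integral) auto
    then show ?thesis
      unfolding Basis prod.reindex[OF inj] o_def by (intro prod.cong) (auto simp: axis_eq_axis)
  qed
  also have "\<dots> = (\<integral>\<^sup>+u. ennreal (?n u * \<bar>u\<bar>) \<partial>lborel)"
    by simp
  also have "\<dots> \<le> ennreal (sqrt v)"
    using assms by (intro nn_integral_abs_normal_density) auto
  finally show ?thesis .
qed

text \<open>Bounding the Euclidean norm by the sum of the absolute coordinates reduces the claim to
  single coordinates; the resulting dimension factor only enters constants. Nonnegative integrals
  give integrability and the bound together.\<close>

lemma (in prob_space) gaussian_norm_expectation:
  fixes X :: "'a \<Rightarrow> real ^ 'd::finite"
  assumes X: "distributed M lborel X (gaussian_density v)" and v: "v > 0"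
  shows "integrable M (\<lambda>\<omega>. norm (X \<omega>))" "expectation (\<lambda>\<omega>. norm (X \<omega>)) \<le> real CARD('d) * sqrt v"
proof -
  have [measurable]: "X \<in> borel_measurable M"
    using X by (simp add: distributed_def)
  have "(\<integral>\<^sup>+\<omega>. ennreal (norm (X \<omega>)) \<partial>M) \<le> (\<integral>\<^sup>+\<omega>. (\<Sum>k\<in>UNIV. ennreal \<bar>X \<omega> $ k\<bar>) \<partial>M)"
    by (intro nn_integral_mono) (simp add: norm_le_l1_cart)
  also have "\<dots> = (\<Sum>k\<in>UNIV. \<integral>\<^sup>+\<omega>. ennreal \<bar>X \<omega> $ k\<bar> \<partial>M)"
    by (intro nn_integral_sum) auto
  also have "\<dots> = (\<Sum>k\<in>(UNIV :: 'd set). \<integral>\<^sup>+z. ennreal (gaussian_density v z) * ennreal \<bar>z $ k\<bar> \<partial>lborel)"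
  proof (rule sum.cong[OF refl])
    fix k
    show "(\<integral>\<^sup>+\<omega>. ennreal \<bar>X \<omega> $ k\<bar> \<partial>M)
        = (\<integral>\<^sup>+z. ennreal (gaussian_density v z) * ennreal \<bar>z $ k\<bar> \<partial>lborel)"
      using distributed_nn_integral[OF X, of "\<lambda>z. ennreal \<bar>z $ k\<bar>"] by simp
  qed
  also have "\<dots> \<le> (\<Sum>k\<in>(UNIV :: 'd set). ennreal (sqrt v))"
    by (intro sum_mono nn_integral_gaussian_density_component v)
  also have "\<dots> = ennreal (real CARD('d) * sqrt v)"
    using v by (simp add: ennreal_mult' ennreal_of_nat_eq_real_of_nat)
  finally have *: "(\<integral>\<^sup>+\<omega>. ennreal (norm (X \<omega>)) \<partial>M) \<le> ennreal (real CARD('d) * sqrt v)" .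
  show int: "integrable M (\<lambda>\<omega>. norm (X \<omega>))"
    using * by (intro integrableI_bounded) (auto intro: le_less_trans)
  show "expectation (\<lambda>\<omega>. norm (X \<omega>)) \<le> real CARD('d) * sqrt v"
    using * v by (subst (asm) nn_integral_eq_integral[OF int]) (auto simp: ennreal_le_iff)
qed

subsection \<open>Expected regret\<close>

lemma borel_measurable_lipschitz:
  fixes g :: "'a::euclidean_space \<Rightarrow> 'b::euclidean_space"
  assumes "0 \<le> L" "\<And>y z. norm (g y - g z) \<le> L * norm (y - z)"
  shows "g \<in> borel_measurable borel"
proof -
  have "L-lipschitz_on UNIV g"
    using assms by (intro lipschitz_onI) (simp_all add: dist_norm)
  then show ?thesis
    by (intro borel_measurable_continuous_onI lipschitz_on_continuous_on)
qed

text \<open>Adaptedness of \<open>x t\<close> is a hypothesis here because the lemma serves the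
  inductions that establish adaptedness of the iterates, before
  \<open>lipschitz_adaptive_sampling\<close> is available.\<close>

lemma (in adaptive_sampling) gradient_estimator_measurable:
  assumes "1 \<le> t" "subalgebra (F (Suc t)) (F t)" "I t \<in> measurable (F (Suc t)) (count_space UNIV)"
    and "x t \<in> borel_measurable (F t)" "\<And>i. grad (f i) \<in> borel_measurable borel"
  shows "gradient_estimator t \<in> borel_measurable (F (Suc t))"
proof -
  note [measurable] = assms(3,5)
  have [measurable]: "x t \<in> borel_measurable (F (Suc t))" "p t \<in> borel_measurable (F (Suc t))"
    using measurable_from_subalg[OF assms(2)] assms(4) p_past[OF assms(1)] by blast+
  show ?thesis
    unfolding gradient_estimator_def
    \<comment> \<open>The random index has finitely many values, so measurability is checked for
      each fixed index.\<close>
    by (rule measurable_compose_countable[where g = "I t"]) measurable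
qed

text \<open>Collects what SGD and SGLD share. No update rule appears: beyond adaptedness, the motion
  of the iterates enters only through the expected length of a step. The filtration \<open>F\<close>
  stays abstract because the two algorithms generate different pasts.\<close>

locale lipschitz_adaptive_sampling = adaptive_sampling M f eps x1 h1 F x h p I
  for M :: "'w measure" and f :: "'n::finite \<Rightarrow> real ^ 'd::finite \<Rightarrow> real"
    and eps x1 h1 F x h p I +
  fixes G L :: real
  assumes grad_bound: "norm (grad (f i) y) \<le> G"
    and L_nonneg: "0 \<le> L"
    and grad_lipschitz: "norm (grad (f i) y - grad (f i) z) \<le> L * norm (y - z)"
    and eps_pos: "1 \<le> t \<Longrightarrow> 0 < eps t"
    and eps_le_1: "1 \<le> t \<Longrightarrow> eps t \<le> 1"
    and eps_Suc_le: "1 \<le> t \<Longrightarrow> eps (Suc t) \<le> eps t"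
    and F_subalgebra: "1 \<le> t \<Longrightarrow> subalgebra M (F t)"
    and F_Suc: "1 \<le> t \<Longrightarrow> subalgebra (F (Suc t)) (F t)"
    and I_adapted: "1 \<le> t \<Longrightarrow> I t \<in> measurable (F (Suc t)) (count_space UNIV)"
    and x_adapted: "1 \<le> t \<Longrightarrow> x t \<in> borel_measurable (F t)"
begin

section \<open>Uniform bounds and adaptedness\<close>

definition N :: real where "N = real CARD('n)"

text \<open>The stored vectors start at an arbitrary \<open>h1\<close>, so \<open>G\<close> is
  enlarged to dominate initial and refreshed entries alike.\<close>

definition B :: real where "B = G + (\<Sum>i\<in>UNIV. norm (h1 i))"

definition staleness :: "nat \<Rightarrow> 'w \<Rightarrow> real" where
  "staleness t \<omega> = (\<Sum>i\<in>UNIV. norm (grad (f i) (x t \<omega>) - h t \<omega> i))"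

lemma G_nonneg: "0 \<le> G"
  using grad_bound norm_ge_zero order_trans by blast

lemma G_le_B: "G \<le> B"
  unfolding B_def by (simp add: sum_nonneg)

lemma grad_le_B: "norm (grad (f i) y) \<le> B"
  using grad_bound G_le_B order_trans by blast

lemma grad_measurable [measurable]: "grad (f i) \<in> borel_measurable borel"
  using L_nonneg grad_lipschitz by (rule borel_measurable_lipschitz)

lemma adapted_M:
  assumes "1 \<le> t"
  shows "x t \<in> borel_measurable M" "p t \<in> borel_measurable M"
  using measurable_from_subalg[OF F_subalgebra[OF assms]] x_adapted[OF assms] p_past[OF assms] by blast+

lemma p_ge: "1 \<le> t \<Longrightarrow> \<omega> \<in> space M \<Longrightarrow> eps t \<le> p t \<omega> $ i"
  using p_argmin[of t \<omega>] by (auto simp: is_arg_min_def prob_simplex_def)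

lemma h_le_B:
  assumes "1 \<le> t" "\<omega> \<in> space M"
  shows "norm (h t \<omega> i) \<le> B"
  using assms(1)
proof (induction t arbitrary: i rule: nat_induct_at_least)
  case base
  have "norm (h1 i) \<le> (\<Sum>i\<in>UNIV. norm (h1 i))"
    by (rule member_le_sum) auto
  then show ?case using h_init[OF assms(2)] G_nonneg by (simp add: B_def)
next
  case (Suc t)
  then show ?case using h_step[OF Suc.hyps assms(2), of i] grad_le_B by simp
qed

lemma h_adapted:
  assumes "1 \<le> t"
  shows "(\<lambda>\<omega>. h t \<omega> i) \<in> borel_measurable (F t)"
  using assms
proof (induction t rule: nat_induct_at_least)
  case base
  have "space (F 1) = space M" using F_subalgebra[of 1] by (simp add: subalgebra_def)
  then show ?case
    by (subst measurable_cong[where g = "\<lambda>_. h1 i"]) (auto simp: h_init simp del: One_nat_def)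
next
  case (Suc t)
  have sp: "space (F (Suc t)) = space M" using F_subalgebra[of "Suc t"] by (simp add: subalgebra_def)
  note [measurable] = measurable_from_subalg[OF F_Suc[OF Suc.hyps] Suc.IH]
    measurable_from_subalg[OF F_Suc[OF Suc.hyps] x_adapted[OF Suc.hyps]] I_adapted[OF Suc.hyps]
  have "(\<lambda>\<omega>. if i = I t \<omega> then grad (f i) (x t \<omega>) else h t \<omega> i) \<in> borel_measurable (F (Suc t))"
    by measurable
  then show ?case
    by (subst measurable_cong) (auto simp: sp h_step[OF Suc.hyps])
qed

lemma stale_gradient_adapted:
  assumes "1 \<le> t"
  shows "(\<lambda>\<omega>. norm (grad (f i) (x t \<omega>) - h t \<omega> i)) \<in> borel_measurable (F t)"
proof -
  note [measurable] = x_adapted[OF assms] h_adapted[OF assms]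
  show ?thesis by measurable
qed

lemma stale_gradient_le:
  assumes "1 \<le> t" "\<omega> \<in> space M"
  shows "norm (grad (f i) (x t \<omega>) - h t \<omega> i) \<le> 2 * B"
  using norm_triangle_ineq4[of "grad (f i) (x t \<omega>)" "h t \<omega> i"] h_le_B[OF assms, of i]
    grad_le_B[of i "x t \<omega>"] by linarith

section \<open>Expectations over the drawn index\<close>

lemma integrable_adapted:
  assumes "1 \<le> t" "Y \<in> borel_measurable (F t)" "\<And>\<omega>. \<omega> \<in> space M \<Longrightarrow> norm (Y \<omega> :: real) \<le> K"
  shows "integrable M Y"
  using measurable_from_subalg[OF F_subalgebra[OF assms(1)] assms(2)] assms(3)
  by (intro integrable_const_bound[of _ K] AE_I2) auto

text \<open>\<open>Y\<close> is determined by the past, so under the expectation the indicator of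
  the draw may be replaced by its conditional expectation given \<open>F t\<close>, which is
  \<open>p t \<omega> $ i\<close> almost surely.\<close>

lemma expectation_draw:
  assumes t: "1 \<le> t" and Y: "Y \<in> borel_measurable (F t)"
    and bound: "\<And>\<omega>. \<omega> \<in> space M \<Longrightarrow> norm (Y \<omega> :: real) \<le> K"
  shows "integrable M (\<lambda>\<omega>. Y \<omega> * of_bool (I t \<omega> = i))"
    "integrable M (\<lambda>\<omega>. Y \<omega> * p t \<omega> $ i)"
    "expectation (\<lambda>\<omega>. Y \<omega> * of_bool (I t \<omega> = i)) = expectation (\<lambda>\<omega>. Y \<omega> * p t \<omega> $ i)"
proof -
  interpret sub: finite_measure_subalgebra M "F t"
    using F_subalgebra[OF t] by unfold_locales
  let ?A = "{\<omega> \<in> space M. I t \<omega> = i}"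
  note [measurable] = I_measurable[OF t] measurable_from_subalg[OF F_subalgebra[OF t] Y] adapted_M(2)[OF t]
  have ind: "Y \<omega> * of_bool (I t \<omega> = i) = Y \<omega> * indicator ?A \<omega>" if "\<omega> \<in> space M" for \<omega>
    using that by simp
  have A: "?A \<in> sets M" by measurable
  have int: "integrable M (\<lambda>\<omega>. Y \<omega> * indicator ?A \<omega>)"
    using integrable_adapted[OF t Y bound] A by (rule integrable_real_mult_indicator[rotated])
  then show "integrable M (\<lambda>\<omega>. Y \<omega> * of_bool (I t \<omega> = i))"
    by (subst Bochner_Integration.integrable_cong[OF refl ind])
  have AE: "AE \<omega> in M. Y \<omega> * real_cond_exp M (F t) (indicator ?A) \<omega> = Y \<omega> * p t \<omega> $ i"
    using I_cond_distr[OF t, of i] by eventually_elim simp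
  have ind_meas: "indicator ?A \<in> borel_measurable M" using A by simp
  note intg = sub.real_cond_exp_intg[OF int Y ind_meas]
  have meas: "(\<lambda>\<omega>. Y \<omega> * real_cond_exp M (F t) (indicator ?A) \<omega>) \<in> borel_measurable M"
    using intg(1) by auto
  show "integrable M (\<lambda>\<omega>. Y \<omega> * p t \<omega> $ i)"
    using intg(1) by (subst (asm) integrable_cong_AE[OF meas _ AE]) auto
  have "expectation (\<lambda>\<omega>. Y \<omega> * p t \<omega> $ i)
      = expectation (\<lambda>\<omega>. Y \<omega> * real_cond_exp M (F t) (indicator ?A) \<omega>)"
    by (intro integral_cong_AE[symmetric] meas AE) auto
  also have "\<dots> = expectation (\<lambda>\<omega>. Y \<omega> * indicator ?A \<omega>)" by (rule intg(2))
  also have "\<dots> = expectation (\<lambda>\<omega>. Y \<omega> * of_bool (I t \<omega> = i))"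
    by (intro Bochner_Integration.integral_cong refl ind[symmetric])
  finally show "expectation (\<lambda>\<omega>. Y \<omega> * of_bool (I t \<omega> = i)) = expectation (\<lambda>\<omega>. Y \<omega> * p t \<omega> $ i)"
    by simp
qed

text \<open>Split according to the drawn index: the weight \<open>1 / p t \<omega> $ i\<close> is
  cancelled by the probability of drawing \<open>i\<close>, so each index contributes at most
  \<open>G\<close>. Unlike the pointwise bound \<open>G / eps t\<close>, the result does not grow
  with \<open>t\<close>.\<close>

lemma gradient_estimator_expectation:
  assumes t: "1 \<le> t"
  shows "integrable M (\<lambda>\<omega>. norm (gradient_estimator t \<omega>))"
    "expectation (\<lambda>\<omega>. norm (gradient_estimator t \<omega>)) \<le> N * G"
proof -
  let ?W = "\<lambda>\<omega>. G * (\<Sum>i\<in>UNIV. 1 / p t \<omega> $ i * of_bool (I t \<omega> = i))"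
  note [measurable] = p_past[OF t] adapted_M[OF t] I_measurable[OF t]
  have pos: "0 < p t \<omega> $ i" if "\<omega> \<in> space M" for \<omega> i
    using p_ge[OF t that] eps_pos[OF t] less_le_trans by blast
  have meas: "(\<lambda>\<omega>. 1 / p t \<omega> $ i) \<in> borel_measurable (F t)" for i
    by measurable
  \<comment> \<open>The bound by \<open>1 / eps t\<close> serves integrability and does not enter
    the estimate of the mean.\<close>
  have bound: "norm (1 / p t \<omega> $ i) \<le> 1 / eps t" if "\<omega> \<in> space M" for \<omega> i
    using pos[OF that, of i] p_ge[OF t that, of i] eps_pos[OF t] by (simp add: frac_le)
  note draw = expectation_draw[OF t meas bound]
  have intW: "integrable M ?W"
    using draw(1) by (intro integrable_mult_right Bochner_Integration.integrable_sum) auto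
  have [measurable]: "gradient_estimator t \<in> borel_measurable M"
    unfolding gradient_estimator_def
    by (rule measurable_compose_countable[where g = "I t"]) measurable
  have le: "norm (gradient_estimator t \<omega>) \<le> ?W \<omega>" if "\<omega> \<in> space M" for \<omega>
  proof -
    have "norm (gradient_estimator t \<omega>) = norm (grad (f (I t \<omega>)) (x t \<omega>)) * (1 / p t \<omega> $ I t \<omega>)"
      using pos[OF that, of "I t \<omega>"] by (simp add: gradient_estimator_def)
    also have "\<dots> \<le> G * (1 / p t \<omega> $ I t \<omega>)"
      using pos[OF that, of "I t \<omega>"] grad_bound by (intro mult_right_mono) auto
    also have "\<dots> = ?W \<omega>"
      by (simp add: of_bool_def if_distrib cong: if_cong)
    finally show ?thesis .
  qed
  show int: "integrable M (\<lambda>\<omega>. norm (gradient_estimator t \<omega>))"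
    using le by (intro Bochner_Integration.integrable_bound[OF intW] AE_I2)
      (auto intro: order_trans[OF _ abs_ge_self])
  have "expectation (\<lambda>\<omega>. norm (gradient_estimator t \<omega>)) \<le> expectation ?W"
    using le by (intro integral_mono[OF int intW])
  also have "\<dots> = G * (\<Sum>i\<in>UNIV. expectation (\<lambda>\<omega>. 1 / p t \<omega> $ i * p t \<omega> $ i))"
    using draw(1,3) by simp
  also have "(\<lambda>i. expectation (\<lambda>\<omega>. 1 / p t \<omega> $ i * p t \<omega> $ i)) = (\<lambda>_. 1)"
  proof
    fix i
    have "expectation (\<lambda>\<omega>. 1 / p t \<omega> $ i * p t \<omega> $ i) = expectation (\<lambda>_. 1)"
      using pos[of _ i] by (intro Bochner_Integration.integral_cong) (auto simp: less_le)
    then show "expectation (\<lambda>\<omega>. 1 / p t \<omega> $ i * p t \<omega> $ i) = 1"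
      by (simp add: prob_space)
  qed
  finally show "expectation (\<lambda>\<omega>. norm (gradient_estimator t \<omega>)) \<le> N * G"
    by (simp add: N_def mult.commute)
qed

section \<open>Contraction of the staleness\<close>

lemma staleness_measurable: "1 \<le> t \<Longrightarrow> staleness t \<in> borel_measurable (F t)"
  unfolding staleness_def using stale_gradient_adapted by (intro borel_measurable_sum)

lemma staleness_bounds:
  assumes "1 \<le> t" "\<omega> \<in> space M"
  shows "0 \<le> staleness t \<omega>" "staleness t \<omega> \<le> 2 * N * B"
  unfolding staleness_def
  using stale_gradient_le[OF assms]
    sum_bounded_above[of UNIV "\<lambda>i. norm (grad (f i) (x t \<omega>) - h t \<omega> i)" "2 * B"]
  by (auto intro: sum_nonneg simp: N_def)

lemma staleness_integrable: "1 \<le> t \<Longrightarrow> integrable M (staleness t)"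
  using staleness_bounds by (intro integrable_adapted[OF _ staleness_measurable, of _ "2 * N * B"]) auto

text \<open>The drawn entry is refreshed with the gradient at the old iterate, so its new error is
  only the Lipschitz drift over one step; every other entry keeps its error up to that drift. Each
  index has conditional probability at least \<open>eps t\<close> of being drawn, which yields the
  factor \<open>1 - eps t\<close>.\<close>

lemma staleness_step:
  assumes t: "1 \<le> t" and int: "integrable M (\<lambda>\<omega>. norm (x (Suc t) \<omega> - x t \<omega>))"
  shows "expectation (staleness (Suc t))
    \<le> (1 - eps t) * expectation (staleness t) + N * L * expectation (\<lambda>\<omega>. norm (x (Suc t) \<omega> - x t \<omega>))"
proof -
  let ?m = "\<lambda>\<omega>. norm (x (Suc t) \<omega> - x t \<omega>)"
  let ?d = "\<lambda>i \<omega>. norm (grad (f i) (x t \<omega>) - h t \<omega> i)"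
  have bd: "norm (?d i \<omega>) \<le> 2 * B" if "\<omega> \<in> space M" for i \<omega>
    using stale_gradient_le[OF t that] by simp
  note draw = expectation_draw[OF t stale_gradient_adapted[OF t] bd]
  have int_d: "integrable M (?d i)" for i
    using integrable_adapted[OF t stale_gradient_adapted[OF t] bd] .
  have pointwise: "staleness (Suc t) \<omega> \<le> N * L * ?m \<omega> + (\<Sum>i\<in>UNIV. ?d i \<omega> - ?d i \<omega> * of_bool (I t \<omega> = i))"
    if \<omega>: "\<omega> \<in> space M" for \<omega>
  proof -
    have "norm (grad (f i) (x (Suc t) \<omega>) - h (Suc t) \<omega> i)
        \<le> L * ?m \<omega> + (?d i \<omega> - ?d i \<omega> * of_bool (I t \<omega> = i))" for i
    proof (cases "I t \<omega> = i")
      case True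
      then show ?thesis using h_step[OF t \<omega>, of i] grad_lipschitz by simp
    next
      case False
      then have "norm (grad (f i) (x (Suc t) \<omega>) - h (Suc t) \<omega> i)
          = norm ((grad (f i) (x (Suc t) \<omega>) - grad (f i) (x t \<omega>)) + (grad (f i) (x t \<omega>) - h t \<omega> i))"
        using h_step[OF t \<omega>, of i] by simp
      also have "\<dots> \<le> L * ?m \<omega> + ?d i \<omega>"
        using norm_triangle_le[OF add_right_mono[OF grad_lipschitz]] by blast
      finally show ?thesis using False by simp
    qed
    then have "staleness (Suc t) \<omega> \<le> (\<Sum>i\<in>UNIV. L * ?m \<omega> + (?d i \<omega> - ?d i \<omega> * of_bool (I t \<omega> = i)))"
      unfolding staleness_def by (intro sum_mono)
    then show ?thesis by (simp add: sum.distrib N_def)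
  qed
  \<comment> \<open>The draw erases, in mean, the error weighted by \<open>p t \<omega> $ i\<close>,
    hence at least the fraction \<open>eps t\<close> of it.\<close>
  have keep: "expectation (\<lambda>\<omega>. ?d i \<omega> - ?d i \<omega> * of_bool (I t \<omega> = i)) \<le> (1 - eps t) * expectation (?d i)" for i
  proof -
    have "eps t * expectation (?d i) = expectation (\<lambda>\<omega>. ?d i \<omega> * eps t)" by simp
    also have "\<dots> \<le> expectation (\<lambda>\<omega>. ?d i \<omega> * p t \<omega> $ i)"
      using p_ge[OF t] by (intro integral_mono integrable_mult_left int_d draw(2)) (auto intro: mult_left_mono)
    also have "\<dots> = expectation (\<lambda>\<omega>. ?d i \<omega> * of_bool (I t \<omega> = i))"
      by (rule draw(3)[symmetric])
    finally show ?thesis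
      using int_d draw(1) by (simp add: algebra_simps)
  qed
  have "expectation (staleness (Suc t))
      \<le> expectation (\<lambda>\<omega>. N * L * ?m \<omega> + (\<Sum>i\<in>UNIV. ?d i \<omega> - ?d i \<omega> * of_bool (I t \<omega> = i)))"
    using int int_d draw(1) pointwise
    by (intro integral_mono staleness_integrable integrable_add Bochner_Integration.integrable_sum
        integrable_diff integrable_mult_right) auto
  also have "\<dots> = N * L * expectation ?m
      + (\<Sum>i\<in>UNIV. expectation (\<lambda>\<omega>. ?d i \<omega> - ?d i \<omega> * of_bool (I t \<omega> = i)))"
    using int int_d draw(1) by simp
  also have "\<dots> \<le> N * L * expectation ?m + (\<Sum>i\<in>UNIV. (1 - eps t) * expectation (?d i))"
    by (intro add_left_mono sum_mono keep)
  also have "\<dots> = (1 - eps t) * expectation (staleness t) + N * L * expectation ?m"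
    using int_d by (simp add: staleness_def[abs_def] sum_distrib_left)
  finally show ?thesis .
qed

section \<open>From single rounds to the regret rate\<close>

definition round_regret :: "nat \<Rightarrow> 'w \<Rightarrow> real" where
  "round_regret t \<omega> = (\<Sum>i\<in>UNIV. (norm (grad (f i) (x t \<omega>)))\<^sup>2 / p t \<omega> $ i)
     - (\<Sum>i\<in>UNIV. norm (grad (f i) (x t \<omega>)))\<^sup>2"

text \<open>The squared norm of the full gradient occurs both in the cost of \<open>p\<close> and in
  the minimum, and cancels; the minimum has the closed form of \<open>true_cost_min\<close>. The
  positive lower bound on \<open>p\<close> keeps all values finite.\<close>

lemma dynamic_regret_eq:
  assumes "\<omega> \<in> space M"
  shows "real_of_ereal (dynamic_regret f x p T \<omega>) = (\<Sum>t=1..T. round_regret t \<omega>)"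
proof -
  have "true_cost (\<lambda>i. grad (f i) (x t \<omega>)) (p t \<omega>) = ereal
      ((\<Sum>i\<in>UNIV. (norm (grad (f i) (x t \<omega>)))\<^sup>2 / p t \<omega> $ i) - (norm (\<Sum>i\<in>UNIV. grad (f i) (x t \<omega>)))\<^sup>2)"
    if "t \<in> {1..T}" for t
    using that assms p_argmin[of t \<omega>] eps_pos[of t] unfolding true_cost_def
    by (subst surrogate_cost_eq_sum[of _ "eps t"]) (auto simp: is_arg_min_def)
  then have "dynamic_regret f x p T \<omega> = ereal (\<Sum>t=1..T. round_regret t \<omega>)"
    unfolding dynamic_regret_def true_cost_min round_regret_def
    by (simp add: sum_subtractf)
  then show ?thesis by simp
qed

lemma round_regret_integrable:
  assumes t: "1 \<le> t"
  shows "integrable M (round_regret t)"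
proof (rule integrable_adapted[OF t, of _ "N * G\<^sup>2 / eps t + (N * G)\<^sup>2"])
  note [measurable] = x_adapted[OF t] p_past[OF t]
  show "round_regret t \<in> borel_measurable (F t)"
    unfolding round_regret_def by measurable
  fix \<omega> assume \<omega>: "\<omega> \<in> space M"
  have pos: "0 < p t \<omega> $ i" for i
    using p_ge[OF t \<omega>] eps_pos[OF t] less_le_trans by blast
  have abs_diff_le: "\<bar>a - b\<bar> \<le> c + d" if "a \<le> c" "0 \<le> a" "b \<le> d" "0 \<le> b" for a b c d :: real
    using that by linarith
  have "(\<Sum>i\<in>UNIV. (norm (grad (f i) (x t \<omega>)))\<^sup>2 / p t \<omega> $ i) \<le> (\<Sum>i\<in>(UNIV :: 'n set). G\<^sup>2 / eps t)"
    using p_ge[OF t \<omega>] eps_pos[OF t] grad_bound by (intro sum_mono frac_le power_mono) auto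
  then have "(\<Sum>i\<in>UNIV. (norm (grad (f i) (x t \<omega>)))\<^sup>2 / p t \<omega> $ i) \<le> N * G\<^sup>2 / eps t"
    by (simp add: N_def)
  moreover have "0 \<le> (\<Sum>i\<in>UNIV. (norm (grad (f i) (x t \<omega>)))\<^sup>2 / p t \<omega> $ i)"
    using pos by (intro sum_nonneg) (simp add: less_imp_le)
  moreover have "(\<Sum>i\<in>UNIV. norm (grad (f i) (x t \<omega>)))\<^sup>2 \<le> (N * G)\<^sup>2"
    using sum_bounded_above[of UNIV "\<lambda>i. norm (grad (f i) (x t \<omega>))" G] grad_bound
    by (intro power_mono) (auto simp: N_def intro: sum_nonneg)
  ultimately show "norm (round_regret t \<omega>) \<le> N * G\<^sup>2 / eps t + (N * G)\<^sup>2"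
    unfolding round_regret_def real_norm_def by (rule abs_diff_le) simp
qed

text \<open>The bound of \<open>argmin_regret_bound\<close> is integrated round by round. The
  staleness part is summed by \<open>weighted_sum_contraction\<close>, with the expected staleness
  as \<open>d\<close>, \<open>2 * N * B\<close> as its bound and \<open>N * L * c t\<close> as the
  drift.\<close>

theorem expected_regret_bound:
  assumes step_integrable: "\<And>t. 1 \<le> t \<Longrightarrow> integrable M (\<lambda>\<omega>. norm (x (Suc t) \<omega> - x t \<omega>))"
    and step_le: "\<And>t. 1 \<le> t \<Longrightarrow> expectation (\<lambda>\<omega>. norm (x (Suc t) \<omega> - x t \<omega>)) \<le> c t"
    and T: "1 \<le> T"
  shows "expectation (\<lambda>\<omega>. real_of_ereal (dynamic_regret f x p T \<omega>))
    \<le> 4 * N * B * (2 * N * B / (eps T)\<^sup>2 + (\<Sum>t=1..T. N * L * c t / (eps t)\<^sup>2))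
      + 4 * N ^ 3 * B\<^sup>2 * (\<Sum>t=1..T. eps t)"
proof -
  let ?s = "\<lambda>t. expectation (staleness t)"
  have NB: "0 \<le> N" "0 \<le> B" using G_nonneg G_le_B by (auto simp: N_def)
  have "expectation (round_regret t) \<le> 4 * N * B * (?s t / eps t) + 4 * N ^ 3 * B\<^sup>2 * eps t"
    if t: "1 \<le> t" for t
  proof -
    have "expectation (round_regret t)
        \<le> expectation (\<lambda>\<omega>. 4 * N * B / eps t * staleness t \<omega> + 4 * N ^ 3 * B\<^sup>2 * eps t)"
    proof (intro integral_mono round_regret_integrable t)
      show "integrable M (\<lambda>\<omega>. 4 * N * B / eps t * staleness t \<omega> + 4 * N ^ 3 * B\<^sup>2 * eps t)"
        using staleness_integrable[OF t] by auto
      show "round_regret t \<omega> \<le> 4 * N * B / eps t * staleness t \<omega> + 4 * N ^ 3 * B\<^sup>2 * eps t"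
        if "\<omega> \<in> space M" for \<omega>
        unfolding round_regret_def staleness_def N_def
        by (intro argmin_regret_bound p_argmin eps_pos eps_le_1 h_le_B grad_le_B t that)
    qed
    also have "\<dots> = 4 * N * B * (?s t / eps t) + 4 * N ^ 3 * B\<^sup>2 * eps t"
      using staleness_integrable[OF t] by (simp add: prob_space)
    finally show ?thesis .
  qed
  then have "(\<Sum>t=1..T. expectation (round_regret t))
      \<le> (\<Sum>t=1..T. 4 * N * B * (?s t / eps t) + 4 * N ^ 3 * B\<^sup>2 * eps t)"
    by (intro sum_mono) auto
  also have "\<dots> = 4 * N * B * (\<Sum>t=1..T. ?s t / eps t) + 4 * N ^ 3 * B\<^sup>2 * (\<Sum>t=1..T. eps t)"
    by (simp add: sum.distrib sum_distrib_left)
  also have "(\<Sum>t=1..T. ?s t / eps t) \<le> 2 * N * B / (eps T)\<^sup>2 + (\<Sum>t=1..T. N * L * c t / (eps t)\<^sup>2)"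
  proof (rule weighted_sum_contraction[where eps = eps and d = ?s, OF eps_pos eps_Suc_le])
    fix t :: nat assume t: "1 \<le> t"
    show "0 \<le> ?s t"
      using staleness_bounds[OF t] by (intro Bochner_Integration.integral_nonneg_AE AE_I2) auto
    have "?s t \<le> expectation (\<lambda>_. 2 * N * B)"
      using staleness_bounds[OF t] by (intro integral_mono staleness_integrable t) auto
    then show "?s t \<le> 2 * N * B" by (simp add: prob_space)
    have "N * L * expectation (\<lambda>\<omega>. norm (x (Suc t) \<omega> - x t \<omega>)) \<le> N * L * c t"
      using NB L_nonneg by (intro mult_left_mono step_le t) auto
    then show "?s (Suc t) \<le> (1 - eps t) * ?s t + N * L * c t"
      using staleness_step[OF t step_integrable[OF t]] by linarith
  qed (use T in auto)
  finally have "(\<Sum>t=1..T. expectation (round_regret t))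
      \<le> 4 * N * B * (2 * N * B / (eps T)\<^sup>2 + (\<Sum>t=1..T. N * L * c t / (eps t)\<^sup>2))
        + 4 * N ^ 3 * B\<^sup>2 * (\<Sum>t=1..T. eps t)"
    using NB by (simp add: mult_left_mono)
  moreover have "expectation (\<lambda>\<omega>. real_of_ereal (dynamic_regret f x p T \<omega>))
      = expectation (\<lambda>\<omega>. \<Sum>t=1..T. round_regret t \<omega>)"
    by (intro Bochner_Integration.integral_cong refl dynamic_regret_eq)
  moreover have "\<dots> = (\<Sum>t=1..T. expectation (round_regret t))"
    by (intro Bochner_Integration.integral_sum round_regret_integrable) auto
  ultimately show ?thesis by simp
qed

lemma dynamic_regret_integrable: "integrable M (\<lambda>\<omega>. real_of_ereal (dynamic_regret f x p T \<omega>))"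
proof -
  have "integrable M (\<lambda>\<omega>. \<Sum>t=1..T. round_regret t \<omega>)"
    by (intro Bochner_Integration.integrable_sum round_regret_integrable) auto
  then show ?thesis
    by (subst Bochner_Integration.integrable_cong[OF refl dynamic_regret_eq])
qed

text \<open>With \<open>k = \<delta> / 3\<close>, the weight at the final time is of order
  \<open>T powr (2 * k)\<close>, the drift terms of order
  \<open>t powr (2 * k - \<delta>) = t powr - k\<close>, and the exploration terms of order
  \<open>t powr - k\<close>. Both sums are of order \<open>T powr (1 - k)\<close>.\<close>

theorem expected_regret_rate:
  assumes eps: "eps = exploration C \<delta>" and C: "1 \<le> C" and \<delta>: "0 \<le> \<delta>" "\<delta> \<le> 1" and D: "0 \<le> D"
    and step_integrable: "\<And>t. 1 \<le> t \<Longrightarrow> integrable M (\<lambda>\<omega>. norm (x (Suc t) \<omega> - x t \<omega>))"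
    and step_le: "\<And>t. 1 \<le> t \<Longrightarrow>
      expectation (\<lambda>\<omega>. norm (x (Suc t) \<omega> - x t \<omega>)) \<le> D * real t powr - \<delta>"
  shows "\<exists>K. \<forall>T. expectation (\<lambda>\<omega>. real_of_ereal (dynamic_regret f x p T \<omega>)) \<le> K * real T powr (1 - \<delta> / 3)"
proof -
  define k where "k = \<delta> / 3"
  have k: "0 \<le> k" "3 * k \<le> 1" "k < 1" using \<delta> by (auto simp: k_def)
  have NB: "0 \<le> N" "0 \<le> B" using G_nonneg G_le_B by (auto simp: N_def)
  note bounds = exploration_bounds[OF C \<delta>, folded eps k_def]
  \<comment> \<open>The three contributions, in order: the weight at the final time, the drift, and
    the price of exploration.\<close>
  define K where "K = 4 * N * B * (2 * N * B * C\<^sup>2 + N * L * D * C\<^sup>2 / (1 - k))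
    + 4 * N ^ 3 * B\<^sup>2 / (1 - k)"
  have inv: "1 / (eps t)\<^sup>2 \<le> C\<^sup>2 * real t powr (2 * k)" if "1 \<le> t" for t
  proof -
    have "(1 / eps t)\<^sup>2 \<le> (C * real t powr k)\<^sup>2"
      using bounds(1,4)[OF that] by (intro power_mono) auto
    then show ?thesis
      using that by (simp add: power_divide power_mult_distrib powr_power mult.commute)
  qed
  have "expectation (\<lambda>\<omega>. real_of_ereal (dynamic_regret f x p T \<omega>)) \<le> K * real T powr (1 - k)" for T
  proof (cases "T = 0")
    \<comment> \<open>Both sides vanish: the regret is a difference of empty sums, and
      \<open>0 powr a\<close> is 0.\<close>
    case True
    then show ?thesis by (simp add: dynamic_regret_def)
  next
    case False
    then have T: "1 \<le> T" by simp
    let ?P = "real T powr (1 - k)"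
    have "2 * N * B * (1 / (eps T)\<^sup>2) \<le> 2 * N * B * (C\<^sup>2 * ?P)"
    proof (rule mult_left_mono)
      \<comment> \<open>Here \<open>\<delta> \<le> 1\<close> enters as
        \<open>2 * k \<le> 1 - k\<close>.\<close>
      have "real T powr (2 * k) \<le> ?P"
        using T k by (intro powr_mono) auto
      then have "C\<^sup>2 * real T powr (2 * k) \<le> C\<^sup>2 * ?P"
        by (intro mult_left_mono) auto
      then show "1 / (eps T)\<^sup>2 \<le> C\<^sup>2 * ?P"
        using inv[OF T] by linarith
    qed (use NB in auto)
    moreover have "(\<Sum>t=1..T. N * L * (D * real t powr - \<delta>) / (eps t)\<^sup>2) \<le> N * L * D * C\<^sup>2 * (?P / (1 - k))"
    proof -
      have "N * L * (D * real t powr - \<delta>) / (eps t)\<^sup>2 \<le> N * L * D * C\<^sup>2 * real t powr - k"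
        if "1 \<le> t" for t
      proof -
        have "N * L * D * real t powr - \<delta> * (1 / (eps t)\<^sup>2)
            \<le> N * L * D * real t powr - \<delta> * (C\<^sup>2 * real t powr (2 * k))"
          using NB L_nonneg D by (intro mult_left_mono inv that) auto
        also have "\<dots> = N * L * D * C\<^sup>2 * (real t powr - \<delta> * real t powr (2 * k))"
          by simp
        also have "real t powr - \<delta> * real t powr (2 * k) = real t powr - k"
          by (simp add: k_def flip: powr_add)
        finally show ?thesis by (simp add: mult.assoc)
      qed
      then have "(\<Sum>t=1..T. N * L * (D * real t powr - \<delta>) / (eps t)\<^sup>2)
          \<le> (\<Sum>t=1..T. N * L * D * C\<^sup>2 * real t powr - k)"
        by (intro sum_mono) auto
      also have "\<dots> \<le> N * L * D * C\<^sup>2 * (?P / (1 - k))"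
        unfolding sum_distrib_left[symmetric]
        using NB L_nonneg D k by (intro mult_left_mono sum_powr_neg_le) auto
      finally show ?thesis .
    qed
    ultimately have "4 * N * B * (2 * N * B / (eps T)\<^sup>2 + (\<Sum>t=1..T. N * L * (D * real t powr - \<delta>) / (eps t)\<^sup>2))
        \<le> 4 * N * B * (2 * N * B * (C\<^sup>2 * ?P) + N * L * D * C\<^sup>2 * (?P / (1 - k)))"
      using NB by (intro mult_left_mono add_mono) auto
    moreover have "4 * N ^ 3 * B\<^sup>2 * (\<Sum>t=1..T. eps t) \<le> 4 * N ^ 3 * B\<^sup>2 * (?P / (1 - k))"
    proof (rule mult_left_mono)
      have "(\<Sum>t=1..T. eps t) \<le> (\<Sum>t=1..T. real t powr - k)"
        using bounds(2) by (intro sum_mono) auto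
      also have "\<dots> \<le> ?P / (1 - k)" using k by (intro sum_powr_neg_le) auto
      finally show "(\<Sum>t=1..T. eps t) \<le> ?P / (1 - k)" .
    qed (use NB in auto)
    moreover have "4 * N * B * (2 * N * B * (C\<^sup>2 * ?P) + N * L * D * C\<^sup>2 * (?P / (1 - k)))
        + 4 * N ^ 3 * B\<^sup>2 * (?P / (1 - k)) = K * ?P"
      unfolding K_def by (simp add: algebra_simps)
    ultimately show ?thesis
      using expected_regret_bound[OF step_integrable step_le T] by linarith
  qed
  then show ?thesis unfolding k_def by blast
qed

end

section \<open>The rates for SGD and SGLD\<close>

theorem corollary1:
  fixes f :: "'n::finite \<Rightarrow> real ^ 'd::finite \<Rightarrow> real"
    and G L C :: real
    and \<alpha> :: "nat \<Rightarrow> real"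
    and x1 :: "real ^ 'd" and h1 :: "'n \<Rightarrow> real ^ 'd"
    and M :: "'w measure"
    and x :: "nat \<Rightarrow> 'w \<Rightarrow> real ^ 'd"
    and h :: "nat \<Rightarrow> 'w \<Rightarrow> 'n \<Rightarrow> real ^ 'd"
    and p :: "nat \<Rightarrow> 'w \<Rightarrow> real ^ 'n"
    and I :: "nat \<Rightarrow> 'w \<Rightarrow> 'n"
    and \<xi> :: "nat \<Rightarrow> 'w \<Rightarrow> real ^ 'd"
  assumes "\<And>i y. f i differentiable (at y)"
    and "G > 0" and "L > 0"
    and "\<And>i y. norm (grad (f i) y) \<le> G"
    and "\<And>i y z. norm (grad (f i) y - grad (f i) z) \<le> L * norm (y - z)"
    and "\<And>t. 1 \<le> t \<Longrightarrow> 0 < \<alpha> t"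
    and "antimono_on {1..} \<alpha>"
    and "\<alpha> \<in> O(\<lambda>t. 1 / real t)"
    and "real CARD('n) \<le> C"
  shows
    "(sgd M f \<alpha> (exploration C 1) x1 h1 x h p I \<longrightarrow>
        (\<exists>K. \<forall>T \<ge> burn_in (real CARD('n)) (exploration C 1).
           integrable M (\<lambda>\<omega>. real_of_ereal (dynamic_regret f x p T \<omega>)) \<and>
           (\<integral>\<omega>. real_of_ereal (dynamic_regret f x p T \<omega>) \<partial>M) \<le> K * real T powr (2 / 3))) \<and>
     (sgld M f \<alpha> (exploration C (1 / 2)) x1 h1 x h p I \<xi> \<longrightarrow>
        (\<exists>K. \<forall>T \<ge> burn_in (real CARD('n)) (exploration C (1 / 2)).
           integrable M (\<lambda>\<omega>. real_of_ereal (dynamic_regret f x p T \<omega>)) \<and>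
           (\<integral>\<omega>. real_of_ereal (dynamic_regret f x p T \<omega>) \<partial>M) \<le> K * real T powr (5 / 6)))"
proof (intro conjI impI)
  have C: "1 \<le> C"
    using assms(9) by (metis One_nat_def Suc_leI finite_UNIV_card_ge_0 finite_class.finite_UNIV of_nat_1
        of_nat_mono order_trans)
  obtain A where A: "A > 0" "\<And>t. 1 \<le> t \<Longrightarrow> \<bar>\<alpha> t\<bar> \<le> A / real t"
    using assms(8) by (rule bigo_inverse_nat_bound) blast
  have \<alpha>_le: "\<alpha> t \<le> A / real t" if "1 \<le> t" for t
    using A(2)[OF that] by simp
  have grad_meas: "grad (f i) \<in> borel_measurable borel" for i
    using assms(3,5) by (intro borel_measurable_lipschitz[of L]) auto
  {
    assume "sgd M f \<alpha> (exploration C 1) x1 h1 x h p I"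
    then interpret sgd M f \<alpha> "exploration C 1" x1 h1 x h p I .
    let ?F = "past M (count_space UNIV) I"
    have sub: "subalgebra M (?F t)" for t
      using I_measurable by (rule subalgebra_past)
    have I_ad: "I t \<in> measurable (?F (Suc t)) (count_space UNIV)" if "1 \<le> t" for t
      using that by (intro measurable_past I_measurable) auto
    \<comment> \<open>For SGD the drawn indices alone determine the iterates, since
      \<open>x1\<close> is deterministic. Adaptedness has to come before the interpretation of the
      common locale, which assumes it.\<close>
    have x_ad: "x t \<in> borel_measurable (?F t)" if "1 \<le> t" for t
      using that
    proof (induction t rule: nat_induct_at_least)
      case base
      then show ?case
        using sub[of 1] by (subst measurable_cong[where g = "\<lambda>_. x1"]) (auto simp: x_init subalgebra_def simp del: One_nat_def)
    next
      case (Suc t)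
      note [measurable] = measurable_from_subalg[OF subalgebra_past_Suc Suc.IH]
        gradient_estimator_measurable[OF Suc.hyps subalgebra_past_Suc I_ad[OF Suc.hyps] Suc.IH grad_meas]
      have "(\<lambda>\<omega>. x t \<omega> - \<alpha> t *\<^sub>R gradient_estimator t \<omega>) \<in> borel_measurable (?F (Suc t))"
        by measurable
      then show ?case
        using sub[of "Suc t"] by (subst measurable_cong) (auto simp: x_step[OF Suc.hyps] subalgebra_def)
    qed
    interpret lipschitz_adaptive_sampling M f "exploration C 1" x1 h1 ?F x h p I G L
      using assms(3-5) C by unfold_locales
        (auto intro: exploration_bounds sub subalgebra_past_Suc I_ad x_ad)
    have step: "norm (x (Suc t) \<omega> - x t \<omega>) = \<alpha> t * norm (gradient_estimator t \<omega>)"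
      if "1 \<le> t" "\<omega> \<in> space M" for t \<omega>
      using x_step[OF that] assms(6)[OF that(1)] by simp
    have int: "integrable M (\<lambda>\<omega>. norm (x (Suc t) \<omega> - x t \<omega>))" if "1 \<le> t" for t
      by (subst Bochner_Integration.integrable_cong[OF refl step[OF that]])
        (auto intro: gradient_estimator_expectation(1)[OF that])
    \<comment> \<open>The decay \<open>1 / t\<close> of the step sizes, times the uniform mean bound
      \<open>N * G\<close> of the estimator, is the step length required for
      \<open>\<delta> = 1\<close>.\<close>
    have "expectation (\<lambda>\<omega>. norm (x (Suc t) \<omega> - x t \<omega>)) \<le> A * (N * G) * real t powr - 1"
      if t: "1 \<le> t" for t
    proof -
      have "expectation (\<lambda>\<omega>. norm (x (Suc t) \<omega> - x t \<omega>)) = \<alpha> t * expectation (\<lambda>\<omega>. norm (gradient_estimator t \<omega>))"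
        by (subst Bochner_Integration.integral_cong[OF refl step[OF t]]) auto
      also have "\<dots> \<le> A / real t * (N * G)"
        using A(1) assms(6)[OF t] by (intro mult_mono \<alpha>_le gradient_estimator_expectation t) auto
      also have "\<dots> = A * (N * G) * real t powr - 1"
        using t by (simp add: powr_minus_divide)
      finally show ?thesis .
    qed
    from expected_regret_rate[OF refl C _ _ _ int this] A(1) assms(2)
    obtain K where "\<And>T. expectation (\<lambda>\<omega>. real_of_ereal (dynamic_regret f x p T \<omega>)) \<le> K * real T powr (2 / 3)"
      by (auto simp: N_def)
    then show "\<exists>K. \<forall>T \<ge> burn_in (real CARD('n)) (exploration C 1).
           integrable M (\<lambda>\<omega>. real_of_ereal (dynamic_regret f x p T \<omega>)) \<and>
           (\<integral>\<omega>. real_of_ereal (dynamic_regret f x p T \<omega>) \<partial>M) \<le> K * real T powr (2 / 3)"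
      using dynamic_regret_integrable by blast
  }
  {
    assume "sgld M f \<alpha> (exploration C (1 / 2)) x1 h1 x h p I \<xi>"
    then interpret sgld M f \<alpha> "exploration C (1 / 2)" x1 h1 x h p I \<xi> .
    let ?Z = "\<lambda>s \<omega>. (I s \<omega>, \<xi> s \<omega>)"
    let ?F = "past M (count_space UNIV \<Otimes>\<^sub>M borel) ?Z"
    have \<xi>_measurable: "\<xi> t \<in> borel_measurable M" if "1 \<le> t" for t
      using noise_distr[OF that] by (simp add: distributed_def)
    have Z: "?Z t \<in> measurable M (count_space UNIV \<Otimes>\<^sub>M borel)" if "1 \<le> t" for t
      using I_measurable[OF that] \<xi>_measurable[OF that] by (rule measurable_Pair)
    have sub: "subalgebra M (?F t)" for t
      using Z by (rule subalgebra_past)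
    have Z_ad: "?Z t \<in> measurable (?F (Suc t)) (count_space UNIV \<Otimes>\<^sub>M borel)" if "1 \<le> t" for t
      using that by (intro measurable_past[where Z = ?Z] Z) auto
    \<comment> \<open>The past is generated by pairs of index and noise, and both components are
      recovered as measurable projections.\<close>
    have I_ad: "I t \<in> measurable (?F (Suc t)) (count_space UNIV)"
      and \<xi>_ad: "\<xi> t \<in> borel_measurable (?F (Suc t))" if "1 \<le> t" for t
      using measurable_compose[OF Z_ad[OF that] measurable_fst]
        measurable_compose[OF Z_ad[OF that] measurable_snd] by simp_all
    have x_ad: "x t \<in> borel_measurable (?F t)" if "1 \<le> t" for t
      using that
    proof (induction t rule: nat_induct_at_least)
      case base
      then show ?case
        using sub[of 1] by (subst measurable_cong[where g = "\<lambda>_. x1"]) (auto simp: x_init subalgebra_def simp del: One_nat_def)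
    next
      case (Suc t)
      note [measurable] = measurable_from_subalg[OF subalgebra_past_Suc Suc.IH] \<xi>_ad[OF Suc.hyps]
        gradient_estimator_measurable[OF Suc.hyps subalgebra_past_Suc I_ad[OF Suc.hyps] Suc.IH grad_meas]
      have "(\<lambda>\<omega>. x t \<omega> - \<alpha> t *\<^sub>R gradient_estimator t \<omega> + \<xi> t \<omega>) \<in> borel_measurable (?F (Suc t))"
        by measurable
      then show ?case
        using sub[of "Suc t"] by (subst measurable_cong) (auto simp: x_step[OF Suc.hyps] subalgebra_def)
    qed
    interpret lipschitz_adaptive_sampling M f "exploration C (1 / 2)" x1 h1 ?F x h p I G L
      using assms(3-5) C by unfold_locales
        (auto intro: exploration_bounds sub subalgebra_past_Suc I_ad x_ad)
    have step: "norm (x (Suc t) \<omega> - x t \<omega>) \<le> \<alpha> t * norm (gradient_estimator t \<omega>) + norm (\<xi> t \<omega>)"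
      if "1 \<le> t" "\<omega> \<in> space M" for t \<omega>
      using x_step[OF that] assms(6)[OF that(1)]
        norm_triangle_ineq[of "- (\<alpha> t *\<^sub>R gradient_estimator t \<omega>)" "\<xi> t \<omega>"] by simp
    have noise: "integrable M (\<lambda>\<omega>. norm (\<xi> t \<omega>))"
      "expectation (\<lambda>\<omega>. norm (\<xi> t \<omega>)) \<le> real CARD('d) * sqrt (2 * \<alpha> t)" if "1 \<le> t" for t
      using gaussian_norm_expectation[OF noise_distr[OF that]] assms(6)[OF that] by auto
    have int': "integrable M (\<lambda>\<omega>. \<alpha> t * norm (gradient_estimator t \<omega>) + norm (\<xi> t \<omega>))" if "1 \<le> t" for t
      using gradient_estimator_expectation(1)[OF that] noise(1)[OF that] by auto
    have int: "integrable M (\<lambda>\<omega>. norm (x (Suc t) \<omega> - x t \<omega>))" if "1 \<le> t" for t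
    proof (rule Bochner_Integration.integrable_bound[OF int'[OF that]])
      have [measurable]: "x s \<in> borel_measurable M" if "1 \<le> s" for s
        using measurable_from_subalg[OF sub x_ad[OF that]] .
      show "(\<lambda>\<omega>. norm (x (Suc t) \<omega> - x t \<omega>)) \<in> borel_measurable M"
        using that by measurable
    qed (use step[OF that] in \<open>auto intro!: AE_I2 intro: order_trans[OF _ abs_ge_self]\<close>)
    \<comment> \<open>The gradient part of a step decays like \<open>1 / t\<close>, the noise, with
      coordinate deviation \<open>sqrt (2 * \<alpha> t)\<close>, only like
      \<open>1 / sqrt t\<close>. The slower noise dictates \<open>\<delta> = 1 / 2\<close>;
      \<open>D\<close> collects both constants.\<close>
    define D where "D = A * (N * G) + real CARD('d) * sqrt (2 * A)"
    have "expectation (\<lambda>\<omega>. norm (x (Suc t) \<omega> - x t \<omega>)) \<le> D * real t powr - (1 / 2)"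
      if t: "1 \<le> t" for t
    proof -
      have sqrt_t: "sqrt (1 / real t) = real t powr - (1 / 2)"
        using t by (simp add: powr_minus_divide powr_half_sqrt real_sqrt_divide)
      have inv_t: "1 / real t \<le> real t powr - (1 / 2)"
        using t powr_mono[of "- 1" "- (1 / 2)" "real t"] by (simp add: powr_minus_divide)
      have "expectation (\<lambda>\<omega>. norm (x (Suc t) \<omega> - x t \<omega>))
          \<le> expectation (\<lambda>\<omega>. \<alpha> t * norm (gradient_estimator t \<omega>) + norm (\<xi> t \<omega>))"
        by (intro integral_mono int int' step t)
      also have "\<dots> = \<alpha> t * expectation (\<lambda>\<omega>. norm (gradient_estimator t \<omega>)) + expectation (\<lambda>\<omega>. norm (\<xi> t \<omega>))"
        using gradient_estimator_expectation(1)[OF t] noise(1)[OF t] by simp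
      also have "\<dots> \<le> A / real t * (N * G) + real CARD('d) * sqrt (2 * (A / real t))"
      proof (rule add_mono)
        show "\<alpha> t * expectation (\<lambda>\<omega>. norm (gradient_estimator t \<omega>)) \<le> A / real t * (N * G)"
          using A(1) by (intro mult_mono \<alpha>_le gradient_estimator_expectation t) auto
        have "real CARD('d) * sqrt (2 * \<alpha> t) \<le> real CARD('d) * sqrt (2 * (A / real t))"
          using \<alpha>_le[OF t] by (intro mult_left_mono real_sqrt_le_mono) auto
        then show "expectation (\<lambda>\<omega>. norm (\<xi> t \<omega>)) \<le> real CARD('d) * sqrt (2 * (A / real t))"
          using noise(2)[OF t] by linarith
      qed
      also have "\<dots> = A * (N * G) * (1 / real t) + real CARD('d) * sqrt (2 * A) * sqrt (1 / real t)"
        by (simp add: real_sqrt_mult real_sqrt_divide)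
      also have "\<dots> \<le> A * (N * G) * real t powr - (1 / 2) + real CARD('d) * sqrt (2 * A) * real t powr - (1 / 2)"
        unfolding sqrt_t using A(1) assms(2) inv_t by (intro add_right_mono mult_left_mono) (auto simp: N_def)
      also have "\<dots> = D * real t powr - (1 / 2)"
        by (simp add: D_def distrib_right)
      finally show ?thesis .
    qed
    from expected_regret_rate[OF refl C _ _ _ int this] A(1) assms(2)
    obtain K where "\<And>T. expectation (\<lambda>\<omega>. real_of_ereal (dynamic_regret f x p T \<omega>)) \<le> K * real T powr (5 / 6)"
      by (auto simp: N_def D_def)
    then show "\<exists>K. \<forall>T \<ge> burn_in (real CARD('n)) (exploration C (1 / 2)).
           integrable M (\<lambda>\<omega>. real_of_ereal (dynamic_regret f x p T \<omega>)) \<and>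
           (\<integral>\<omega>. real_of_ereal (dynamic_regret f x p T \<omega>) \<partial>M) \<le> K * real T powr (5 / 6)"
      using dynamic_regret_integrable by blast
  }
qed

end
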